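(* Let $\mu,\gamma\in\mathbb{C}$ with $\mu\notin\mathbb{Z}_{\ge0}$. Let $N,l,m$ be integers with $0\le l\le N$ and $0\le m\le N$. Then the generalized Clebsch–Gordan coefficients of the intertwining map $\Phi_{q,\mu+\gamma-2l}^{x^\gamma_{\gamma-2l}}:M_{q,\mu+\gamma-2l}\to M_{q,\mu}\otimes M_{q,\gamma}$ can be expressed in terms of $q$-Hahn polynomials, or in terms of $q$-hypergeometric functions, as follows: $$\mathcal{C}_{q,\,\mu-2m,\,\gamma-2N+2m,\,\mu+\gamma-2N}^{\,\mu,\,\gamma,\,\mu+\gamma-2l}=q^{\frac m4(\mu+\gamma)-\frac\mu4(N-l)-\frac12m(N-m)}\begin{bmatrix} N \\ m \end{bmatrix}_q\,Q_l(q^{-m};q^{-\mu-1},q^{-\gamma-1},N;q)$$ $$=q^{\frac m4(\mu+\gamma)-\frac\mu4(N-l)-\frac12m(N-m)}\begin{bmatrix} N \\ m \end{bmatrix}_q\;{}_3\phi_2\!\left(\begin{matrix} q^{-l},\,q^{-\gamma-\mu+l-1},\,q^{-m} \\ {q^{-N}},\,q^{-\mu} \end{matrix};q,q\right).$$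
   Context: Fix $0<q<1$, $q^z:=\exp(z\ln q)$. Notation: $[a]_q:=\frac{q^{a/2}-q^{-a/2}}{q^{1/2}-q^{-1/2}}$; $(a;q)_k:=\prod_{i=0}^{k-1}(1-aq^i)$; $\begin{bmatrix} N \\ m \end{bmatrix}_q:=\frac{(q;q)_N}{(q;q)_m(q;q)_{N-m}}$; ${}_3\phi_2\left(\begin{matrix} a_1,a_2,a_3 \\ {b_1},b_2 \end{matrix};q,z\right):=\sum_{k\ge0}\frac{(a_1;q)_k(a_2;q)_k(a_3;q)_k}{(b_1;q)_k(b_2;q)_k(q;q)_k}z^k$, where, if some numerator parameters equal $q^{-r}$ with $r\in\mathbb{Z}_{\ge0}$, the sum terminates at the smallest such $r$. The $q$-Hahn polynomials are $Q_l(q^{-m};a,b,N;q):={}_3\phi_2\left(\begin{matrix} q^{-l},q^{l+1}ab,q^{-m} \\ {qa},q^{-N} \end{matrix};q,q\right)$, $N\in\mathbb{Z}_{\ge0}$, $l\in\{0,1,\dots,N\}$. $\mathcal U_q=\mathcal U_q(sl(2,\mathbb{C}))$: a $\mathcal U_q$-module is a complex vector space $V$ with linear operators $e,f,h$ such that $V=\bigoplus_\lambda V[\lambda]$, $V[\lambda]=\{v:hv=\lambda v\}$, $eV[\lambda]\subset V[\lambda+2]$, $fV[\lambda]\subset V[\lambda-2]$, $ef-fe$ acts on $V[\lambda]$ as $[\lambda]_q$, and the real parts of the occurring weights are bounded above. $q^{ch}$ acts on $V[\lambda]$ as $q^{c\lambda}$. On tensor products, $\mathcal U_q$ acts by $\Delta(h)=h\otimes1+1\otimes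 h$, $\Delta(e)=e\otimes q^{h/4}+q^{-h/4}\otimes e$, $\Delta(f)=f\otimes q^{h/4}+q^{-h/4}\otimes f$. An intertwining map is a linear map commuting with $e,f,h$. The Verma module $M_{q,\lambda}$ ($\lambda\in\mathbb{C}$) has basis $x^\lambda_{\lambda-2k}:=f^k\cdot x_\lambda$ ($k\in\mathbb{Z}_{\ge0}$), with $h x^\lambda_{\lambda-2k}=(\lambda-2k)x^\lambda_{\lambda-2k}$, $f x^\lambda_{\lambda-2k}=x^\lambda_{\lambda-2k-2}$, $e x^\lambda_{\lambda-2k}=[k]_q[\lambda-k+1]_q x^\lambda_{\lambda-2k+2}$ (in particular $e x_\lambda=0$). Intertwining map: for a $\mathcal U_q$-module $V$, $\lambda,\mu\in\mathbb{C}$ with $\mu\notin\mathbb{Z}_{\ge0}$ and $0\ne v\in V[\lambda-\mu]$, $\Phi_{q,\lambda}^v:M_{q,\lambda}\to M_{q,\mu}\otimes V$ is the unique intertwining map such that $\Phi_{q,\lambda}^v(x_\lambda)=\sum_{k\ge0}f^k\cdot x_\mu\otimes v_k$ with $v_0=v$. Generalized Clebsch–Gordan coefficients: for $\lambda,\mu,\gamma\in\mathbb{C}$ with $\mu\notin\mathbb{Z}_{\ge0}$ and $\mu+\gamma-\lambda\in2\mathbb{Z}_{\ge0}$, and for all $n\in\mathbb{Z}_{\ge0}$, $$\Phi_{q,\lambda}^{x^\gamma_{\lambda-\mu}}(x^\lambda_{\lambda-2n})=\sum_{m=0}^{n+\frac12(\mu+\gamma-\lambda)}\mathcal{C}_{q,\,\mu-2m,\,\lambda-\mu+2m-2n,\,\lambda-2n}^{\,\mu,\,\gamma,\,\lambda}\;x^\mu_{\mu-2m}\otimes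 x^\gamma_{\lambda-\mu+2m-2n}.$$ (The claim uses $\lambda=\mu+\gamma-2l$ and $n=N-l$.)
   Formalization: Besides μ∉Z≥0, the formal statement assumes [μ−k]_q≠0 for all integers 0≤k<l; when this fails (e.g. μ=k+2πi j/ln q with j≠0 and k<l) the intertwining map does not exist or is not unique, so the coefficients are undefined. *)

theory Defs
  imports "HOL-Analysis.Analysis" "HOL-Library.Poly_Mapping"
begin

section \<open>Basic hypergeometric notation\<close>

text \<open>For a real \<open>0 < q\<close> the term \<open>complex_of_real q powr z\<close> is \<open>exp (z * ln q)\<close>
  with the real logarithm.\<close>

abbreviation qpow :: "real \<Rightarrow> complex \<Rightarrow> complex" where
  "qpow q z \<equiv> complex_of_real q powr z"

definition qnum :: "real \<Rightarrow> complex \<Rightarrow> complex" where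
  "qnum q a = (qpow q (a / 2) - qpow q (- a / 2)) / (qpow q (1 / 2) - qpow q (- 1 / 2))"

definition qpoch :: "complex \<Rightarrow> real \<Rightarrow> nat \<Rightarrow> complex" where
  "qpoch a q k = (\<Prod>i<k. 1 - a * complex_of_real q ^ i)"

definition qbinom :: "real \<Rightarrow> nat \<Rightarrow> nat \<Rightarrow> complex" where
  "qbinom q N m =
     qpoch (complex_of_real q) q N / (qpoch (complex_of_real q) q m * qpoch (complex_of_real q) q (N - m))"

definition phi32_term ::
  "complex \<Rightarrow> complex \<Rightarrow> complex \<Rightarrow> complex \<Rightarrow> complex \<Rightarrow> real \<Rightarrow> complex \<Rightarrow> nat \<Rightarrow> complex" where
  "phi32_term a1 a2 a3 b1 b2 q z k =
     (qpoch a1 q k * qpoch a2 q k * qpoch a3 q k)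
     / (qpoch b1 q k * qpoch b2 q k * qpoch (complex_of_real q) q k) * z ^ k"

text \<open>The explicit truncation matters: for \<open>k\<close> beyond the smallest \<open>r\<close> with \<open>q\<^sup>-\<^sup>r\<close> among the
  numerator parameters, the lower parameter \<open>q\<^sup>-\<^sup>N\<close> of a \<open>q\<close>-Hahn polynomial
  makes the terms undefined.\<close>

definition phi32 ::
  "complex \<Rightarrow> complex \<Rightarrow> complex \<Rightarrow> complex \<Rightarrow> complex \<Rightarrow> real \<Rightarrow> complex \<Rightarrow> complex" where
  "phi32 a1 a2 a3 b1 b2 q z =
     (if \<exists>r::nat. qpow q (- of_nat r) \<in> {a1, a2, a3}
      then \<Sum>k \<le> (LEAST r::nat. qpow q (- of_nat r) \<in> {a1, a2, a3}). phi32_term a1 a2 a3 b1 b2 q z k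
      else suminf (phi32_term a1 a2 a3 b1 b2 q z))"

text \<open>\<open>q_hahn l x a b N q\<close> is \<open>Q\<^sub>l(x; a, b, N; q)\<close>, where \<open>x = q\<^sup>-\<^sup>m\<close>.\<close>

definition q_hahn ::
  "nat \<Rightarrow> complex \<Rightarrow> complex \<Rightarrow> complex \<Rightarrow> nat \<Rightarrow> real \<Rightarrow> complex" where
  "q_hahn l x a b N q =
     phi32 (qpow q (- of_nat l)) (qpow q (of_nat l + 1) * a * b) x
           (complex_of_real q * a) (qpow q (- of_nat N)) q (complex_of_real q)"


section \<open>Complex vector spaces with a basis\<close>

text \<open>The vector space with basis indexed by \<open>'b\<close> is \<open>'b \<Rightarrow>\<^sub>0 complex\<close>; the basis vector with
  index \<open>b\<close> is \<open>bas b\<close>. The tensor product of the spaces on \<open>'a\<close> and on \<open>'b\<close> is the space on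
  \<open>'a \<times> 'b\<close>.\<close>

definition scale :: "complex \<Rightarrow> ('b \<Rightarrow>\<^sub>0 complex) \<Rightarrow> ('b \<Rightarrow>\<^sub>0 complex)" where
  "scale c p = Poly_Mapping.map ((*) c) p"

definition bas :: "'b \<Rightarrow> ('b \<Rightarrow>\<^sub>0 complex)" where
  "bas b = Poly_Mapping.single b 1"

definition lin_ext :: "('b \<Rightarrow> ('c \<Rightarrow>\<^sub>0 complex)) \<Rightarrow> ('b \<Rightarrow>\<^sub>0 complex) \<Rightarrow> ('c \<Rightarrow>\<^sub>0 complex)" where
  "lin_ext g p = (\<Sum>b\<in>Poly_Mapping.keys p. scale (Poly_Mapping.lookup p b) (g b))"

definition tens :: "('a \<Rightarrow>\<^sub>0 complex) \<Rightarrow> ('b \<Rightarrow>\<^sub>0 complex) \<Rightarrow> ('a \<times> 'b \<Rightarrow>\<^sub>0 complex)" where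
  "tens v w = lin_ext (\<lambda>a. lin_ext (\<lambda>b. bas (a, b)) w) v"

definition tens_op ::
  "(('a \<Rightarrow>\<^sub>0 complex) \<Rightarrow> ('a \<Rightarrow>\<^sub>0 complex)) \<Rightarrow> (('b \<Rightarrow>\<^sub>0 complex) \<Rightarrow> ('b \<Rightarrow>\<^sub>0 complex))
   \<Rightarrow> ('a \<times> 'b \<Rightarrow>\<^sub>0 complex) \<Rightarrow> ('a \<times> 'b \<Rightarrow>\<^sub>0 complex)" where
  "tens_op A B = lin_ext (\<lambda>(a, b). tens (A (bas a)) (B (bas b)))"

lemma lookup_scale [simp]: "Poly_Mapping.lookup (scale c p) b = c * Poly_Mapping.lookup p b"
  by (simp add: scale_def Poly_Mapping.map.rep_eq when_def)

lemma vector_space_scale: "vector_space scale"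
  by standard (auto intro!: poly_mapping_eqI simp: lookup_add algebra_simps)

lemma lin_ext_superset:
  assumes "finite S" "Poly_Mapping.keys p \<subseteq> S"
  shows "lin_ext g p = (\<Sum>b\<in>S. scale (Poly_Mapping.lookup p b) (g b))"
  unfolding lin_ext_def using assms
  by (intro sum.mono_neutral_left)
     (auto simp: in_keys_iff intro!: poly_mapping_eqI)

lemma lin_ext_bas [simp]: "lin_ext g (bas b) = g b"
  by (auto simp: lin_ext_def bas_def intro!: poly_mapping_eqI)

lemma lin_ext_add: "lin_ext g (x + y) = lin_ext g x + lin_ext g y"
proof -
  let ?S = "Poly_Mapping.keys x \<union> Poly_Mapping.keys y"
  have "Poly_Mapping.keys (x + y) \<subseteq> ?S" by (rule Poly_Mapping.keys_add)
  then show ?thesis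
    by (simp add: lin_ext_superset[of ?S] lookup_add sum.distrib
          vector_space.vector_space_assms(2)[OF vector_space_scale])
qed

lemma scale_sum: "scale c (sum f A) = (\<Sum>a\<in>A. scale c (f a))"
  by (auto intro!: poly_mapping_eqI simp: lookup_sum sum_distrib_left)

lemma lin_ext_scale: "lin_ext g (scale c x) = scale c (lin_ext g x)"
proof -
  have "Poly_Mapping.keys (scale c x) \<subseteq> Poly_Mapping.keys x"
    by (auto simp: in_keys_iff)
  then show ?thesis
    by (simp add: lin_ext_superset[of "Poly_Mapping.keys x"] scale_sum
          vector_space.vector_space_assms(3)[OF vector_space_scale])
qed

lemma lin_ext_zero [simp]: "lin_ext g 0 = 0"
  by (simp add: lin_ext_def)

lemma scale_simps:
  "scale c (v + w) = scale c v + scale c w" "scale c (v - w) = scale c v - scale c w"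
  "scale c (scale d v) = scale (c * d) v"
  "scale (c + d) v = scale c v + scale d v" "scale (c - d) v = scale c v - scale d v"
  "scale c 0 = 0" "scale 0 v = 0" "scale 1 v = v"
  by (auto intro!: poly_mapping_eqI simp: lookup_add lookup_minus algebra_simps)

lemma linear_lin_ext: "Vector_Spaces.linear scale scale (lin_ext g)"
  by (simp add: Vector_Spaces.linear_iff vector_space_scale lin_ext_add lin_ext_scale)

lemma bas_induct:
  assumes "\<And>b. P (bas b)" "\<And>c v. P v \<Longrightarrow> P (scale c v)" "\<And>v w. P v \<Longrightarrow> P w \<Longrightarrow> P (v + w)" "P 0"
  shows "P v"
proof -
  have "P (\<Sum>b\<in>A. scale (Poly_Mapping.lookup v b) (bas b))" if "finite A" for A
    using that by induction (use assms in auto)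
  moreover have "v = (\<Sum>b\<in>Poly_Mapping.keys v. scale (Poly_Mapping.lookup v b) (bas b))"
    by (auto intro!: poly_mapping_eqI
          simp: lookup_sum bas_def lookup_single when_def in_keys_iff if_distrib sum.delta
          cong: if_cong)
  ultimately show ?thesis by (metis finite_keys)
qed


section \<open>Modules over \<open>U\<^sub>q(sl(2))\<close>\<close>

text \<open>Since a \<open>U\<^sub>q\<close>-module is the direct sum of its weight spaces, it has a basis of weight
  vectors. It is given by the weights of such a basis (which determine \<open>h\<close>) and the operators
  \<open>e\<close> and \<open>f\<close>.\<close>

record 'b uq_mod =
  wt :: "'b \<Rightarrow> complex"
  opE :: "('b \<Rightarrow>\<^sub>0 complex) \<Rightarrow> ('b \<Rightarrow>\<^sub>0 complex)"
  opF :: "('b \<Rightarrow>\<^sub>0 complex) \<Rightarrow> ('b \<Rightarrow>\<^sub>0 complex)"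

definition opH :: "'b uq_mod \<Rightarrow> ('b \<Rightarrow>\<^sub>0 complex) \<Rightarrow> ('b \<Rightarrow>\<^sub>0 complex)" where
  "opH V = lin_ext (\<lambda>b. scale (wt V b) (bas b))"

text \<open>The operator \<open>q\<^sup>c\<^sup>h\<close>.\<close>

definition opK :: "real \<Rightarrow> complex \<Rightarrow> 'b uq_mod \<Rightarrow> ('b \<Rightarrow>\<^sub>0 complex) \<Rightarrow> ('b \<Rightarrow>\<^sub>0 complex)" where
  "opK q c V = lin_ext (\<lambda>b. scale (qpow q (c * wt V b)) (bas b))"

definition weight_space :: "'b uq_mod \<Rightarrow> complex \<Rightarrow> ('b \<Rightarrow>\<^sub>0 complex) set" where
  "weight_space V \<nu> = {v. opH V v = scale \<nu> v}"

definition uq_module :: "real \<Rightarrow> 'b uq_mod \<Rightarrow> bool" where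
  "uq_module q V \<longleftrightarrow>
     Vector_Spaces.linear scale scale (opE V) \<and> Vector_Spaces.linear scale scale (opF V) \<and>
     (\<forall>\<nu>. \<forall>v\<in>weight_space V \<nu>.
        opE V v \<in> weight_space V (\<nu> + 2) \<and> opF V v \<in> weight_space V (\<nu> - 2) \<and>
        opE V (opF V v) - opF V (opE V v) = scale (qnum q \<nu>) v) \<and>
     (\<exists>B. \<forall>b. Re (wt V b) \<le> B)"

definition uq_tensor :: "real \<Rightarrow> 'a uq_mod \<Rightarrow> 'b uq_mod \<Rightarrow> ('a \<times> 'b) uq_mod" where
  "uq_tensor q V W = \<lparr>
     wt = (\<lambda>(a, b). wt V a + wt W b),
     opE = (\<lambda>u. tens_op (opE V) (opK q (1/4) W) u + tens_op (opK q (-1/4) V) (opE W) u),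
     opF = (\<lambda>u. tens_op (opF V) (opK q (1/4) W) u + tens_op (opK q (-1/4) V) (opF W) u) \<rparr>"

definition intertwining ::
  "'a uq_mod \<Rightarrow> 'b uq_mod \<Rightarrow> (('a \<Rightarrow>\<^sub>0 complex) \<Rightarrow> ('b \<Rightarrow>\<^sub>0 complex)) \<Rightarrow> bool" where
  "intertwining V W \<Phi> \<longleftrightarrow> Vector_Spaces.linear scale scale \<Phi> \<and>
     (\<forall>v. \<Phi> (opE V v) = opE W (\<Phi> v) \<and> \<Phi> (opF V v) = opF W (\<Phi> v) \<and> \<Phi> (opH V v) = opH W (\<Phi> v))"

text \<open>The basis vector of index \<open>k\<close> is \<open>x\<^sup>\<nu>\<close> with lower index \<open>\<nu> - 2k\<close>. In \<open>opE\<close> the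
  truncated \<open>k - 1\<close> at \<open>k = 0\<close> is harmless because of the factor \<open>qnum q 0 = 0\<close>.\<close>

definition verma :: "real \<Rightarrow> complex \<Rightarrow> nat uq_mod" where
  "verma q \<nu> = \<lparr>
     wt = (\<lambda>k. \<nu> - 2 * of_nat k),
     opE = lin_ext (\<lambda>k. scale (qnum q (of_nat k) * qnum q (\<nu> - of_nat k + 1)) (bas (k - 1))),
     opF = lin_ext (\<lambda>k. bas (Suc k)) \<rparr>"

lemma lookup_diag:
  "Poly_Mapping.lookup (lin_ext (\<lambda>b. scale (c b) (bas b)) v) b = c b * Poly_Mapping.lookup v b"
proof (induction v rule: bas_induct)
  case (1 b')
  have "Poly_Mapping.lookup (bas b') b = 0" if "b' \<noteq> b"
    using that by (simp add: bas_def lookup_single)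
  then show ?case by (cases "b' = b") simp_all
qed (simp_all add: lin_ext_add lin_ext_scale lookup_add algebra_simps lin_ext_zero)

lemma weight_space_diag:
  assumes "v \<in> weight_space V \<kappa>"
  shows "lin_ext (\<lambda>b. scale (c (wt V b)) (bas b)) v = scale (c \<kappa>) v"
proof (rule poly_mapping_eqI)
  fix b
  have "wt V b * Poly_Mapping.lookup v b = \<kappa> * Poly_Mapping.lookup v b"
    using assms unfolding weight_space_def opH_def mem_Collect_eq by (metis lookup_diag lookup_scale)
  then show "Poly_Mapping.lookup (lin_ext (\<lambda>b. scale (c (wt V b)) (bas b)) v) b
      = Poly_Mapping.lookup (scale (c \<kappa>) v) b"
    by (auto simp: lookup_diag)
qed

lemma qnum_identity:
  assumes "0 < q" "q < 1"
  shows "qnum q (k + 1) * qnum q (\<nu> - k) - qnum q k * qnum q (\<nu> - k + 1) = qnum q (\<nu> - 2 * k)"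
proof -
  define x y s where "x = qpow q (k / 2)" and "y = qpow q ((\<nu> - k) / 2)" and "s = qpow q (1 / 2)"
  have nz: "x \<noteq> 0" "y \<noteq> 0" "s \<noteq> 0" using assms by (auto simp: x_def y_def s_def)
  have "s * s = qpow q (1 / 2 + 1 / 2)"
    unfolding s_def powr_add ..
  then have "s * s = complex_of_real q" using assms by simp
  then have "s * s \<noteq> 1" using assms by simp
  then have s1: "s - 1 / s \<noteq> 0" using nz by (simp add: field_simps)
  have inv: "qpow q (- z / 2) = 1 / qpow q (z / 2)" for z
    unfolding minus_divide_left[symmetric] powr_minus by (rule inverse_eq_divide)
  have qn: "qnum q z = (w - 1 / w) / (s - 1 / s)" if "qpow q (z / 2) = w" for z w
    unfolding qnum_def inv that s_def ..
  have F1: "qnum q (k + 1) = (x * s - 1 / (x * s)) / (s - 1 / s)"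
    by (rule qn) (simp only: x_def s_def add_divide_distrib powr_add)
  have F2: "qnum q (\<nu> - k) = (y - 1 / y) / (s - 1 / s)"
    by (rule qn) (simp only: y_def)
  have F3: "qnum q k = (x - 1 / x) / (s - 1 / s)"
    by (rule qn) (simp only: x_def)
  have F4: "qnum q (\<nu> - k + 1) = (y * s - 1 / (y * s)) / (s - 1 / s)"
    by (rule qn) (simp only: y_def s_def add_divide_distrib powr_add)
  have F5: "qnum q (\<nu> - 2 * k) = (y / x - 1 / (y / x)) / (s - 1 / s)"
  proof (rule qn)
    have e: "(\<nu> - 2 * k) / 2 = (\<nu> - k) / 2 - k / 2" by (simp add: field_simps)
    show "qpow q ((\<nu> - 2 * k) / 2) = y / x"
      unfolding e x_def y_def by (rule powr_diff)
  qed
  have F6: "(x * s - 1 / (x * s)) * (y - 1 / y) - (x - 1 / x) * (y * s - 1 / (y * s))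
      = (y / x - 1 / (y / x)) * (s - 1 / s)"
    using nz by (simp add: divide_simps) (simp add: algebra_simps)
  have F7: "a / d * (b / d) - a' / d * (b' / d) = c / d"
    if "a * b - a' * b' = c * d" "d \<noteq> 0" for a b a' b' c d :: complex
  proof -
    have "a / d * (b / d) - a' / d * (b' / d) = (a * b - a' * b') / (d * d)"
      by (simp add: diff_divide_distrib)
    then show ?thesis using that by simp
  qed
  show ?thesis unfolding F1 F2 F3 F4 F5 by (rule F7[OF F6 s1])
qed

lemma uq_module_verma:
  assumes "0 < q" "q < 1"
  shows "uq_module q (verma q \<nu>)"
proof -
  let ?V = "verma q \<nu>"
  note lin = lin_ext_add lin_ext_scale
  note sc = scale_simps
  have q0: "qnum q 0 = 0" by (simp add: qnum_def)
  have HE: "opH ?V (opE ?V v) = opE ?V (opH ?V v) + scale 2 (opE ?V v)" for v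
  proof (induction v rule: bas_induct)
    case (1 k)
    show ?case
    proof (cases k)
      case 0
      then show ?thesis by (simp add: opH_def verma_def lin sc q0)
    next
      case (Suc j)
      define c where "c = qnum q (of_nat k) * qnum q (\<nu> - of_nat k + 1)"
      have E: "opE ?V (bas k) = scale c (bas j)" by (simp add: verma_def c_def Suc)
      have H: "opH ?V (scale d (bas i)) = scale (d * (\<nu> - 2 * of_nat i)) (bas i)" for d i
        by (simp add: opH_def verma_def lin sc(3))
      have "opH ?V (opE ?V (bas k)) = scale (c * (\<nu> - 2 * of_nat j)) (bas j)"
        unfolding E H ..
      moreover have "opE ?V (opH ?V (bas k)) = scale ((\<nu> - 2 * of_nat k) * c) (bas j)"
      proof -
        have H1: "opH ?V (bas k) = scale (\<nu> - 2 * of_nat k) (bas k)"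
          using H[of 1 k] unfolding sc(8) mult_1 .
        have "opE ?V (scale d (bas k)) = scale d (opE ?V (bas k))" for d
          by (simp add: verma_def lin)
        then show ?thesis unfolding H1 E sc(3) .
      qed
      moreover have "(\<nu> - 2 * of_nat k) * c + 2 * c = c * (\<nu> - 2 * of_nat j)"
        by (simp add: Suc algebra_simps)
      ultimately show ?thesis unfolding E by (metis sc(3) sc(4))
    qed
  next
    case (2 c v)
    have "opH ?V (opE ?V (scale c v)) = scale c (opH ?V (opE ?V v))"
      "opE ?V (opH ?V (scale c v)) = scale c (opE ?V (opH ?V v))"
      "opE ?V (scale c v) = scale c (opE ?V v)"
      by (simp_all add: opH_def verma_def lin)
    then show ?case unfolding 2 by (simp add: sc mult.commute)
  next
    case (3 v w)
    have "opH ?V (opE ?V (v + w)) = opH ?V (opE ?V v) + opH ?V (opE ?V w)"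
      "opE ?V (opH ?V (v + w)) = opE ?V (opH ?V v) + opE ?V (opH ?V w)"
      "opE ?V (v + w) = opE ?V v + opE ?V w"
      by (simp_all add: opH_def verma_def lin)
    then show ?case unfolding 3 by (simp add: sc)
  qed (simp add: opH_def verma_def sc)
  have HF: "opH ?V (opF ?V v) = opF ?V (opH ?V v) - scale 2 (opF ?V v)" for v
  proof (induction v rule: bas_induct)
    case (1 k)
    have "\<nu> - 2 * of_nat (Suc k) = (\<nu> - 2 * of_nat k) - 2" by simp
    then show ?case
      by (simp add: opH_def verma_def lin del: of_nat_Suc) (simp add: sc)
  next
    case (2 c v)
    have "opH ?V (opF ?V (scale c v)) = scale c (opH ?V (opF ?V v))"
      "opF ?V (opH ?V (scale c v)) = scale c (opF ?V (opH ?V v))"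
      "opF ?V (scale c v) = scale c (opF ?V v)"
      by (simp_all add: opH_def verma_def lin)
    then show ?case unfolding 2 by (simp add: sc mult.commute)
  next
    case (3 v w)
    have "opH ?V (opF ?V (v + w)) = opH ?V (opF ?V v) + opH ?V (opF ?V w)"
      "opF ?V (opH ?V (v + w)) = opF ?V (opH ?V v) + opF ?V (opH ?V w)"
      "opF ?V (v + w) = opF ?V v + opF ?V w"
      by (simp_all add: opH_def verma_def lin)
    then show ?case unfolding 3 by (simp add: sc)
  qed (simp add: opH_def verma_def sc)
  have EF: "opE ?V (opF ?V v) - opF ?V (opE ?V v)
      = lin_ext (\<lambda>b. scale (qnum q (wt ?V b)) (bas b)) v" for v
  proof (induction v rule: bas_induct)
    case (1 k)
    have "opE ?V (opF ?V (bas k)) - opF ?V (opE ?V (bas k)) =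
       scale (qnum q (of_nat k + 1) * qnum q (\<nu> - of_nat k)
              - qnum q (of_nat k) * qnum q (\<nu> - of_nat k + 1)) (bas k)"
      by (cases k) (auto simp: verma_def lin sc q0 algebra_simps)
    then show ?case
      unfolding qnum_identity[OF assms] by (simp add: verma_def)
  next
    case (2 c v)
    have "opE ?V (opF ?V (scale c v)) - opF ?V (opE ?V (scale c v))
        = scale c (opE ?V (opF ?V v) - opF ?V (opE ?V v))"
      by (simp add: verma_def lin sc)
    then show ?case by (simp add: 2 lin)
  next
    case (3 v w)
    have "opE ?V (opF ?V (v + w)) - opF ?V (opE ?V (v + w))
        = (opE ?V (opF ?V v) - opF ?V (opE ?V v)) + (opE ?V (opF ?V w) - opF ?V (opE ?V w))"
      by (simp add: verma_def lin)
    then show ?case by (simp add: 3 lin)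
  qed (simp add: verma_def lin_ext_def)
  show ?thesis
    unfolding uq_module_def
  proof (intro conjI allI ballI)
    show "Vector_Spaces.linear scale scale (opE ?V)" "Vector_Spaces.linear scale scale (opF ?V)"
      by (simp_all add: verma_def linear_lin_ext)
    show "\<exists>B. \<forall>b. Re (wt ?V b) \<le> B"
      by (rule exI[of _ "Re \<nu>"]) (simp add: verma_def)
    fix \<kappa> v assume v: "v \<in> weight_space ?V \<kappa>"
    then have w: "opH ?V v = scale \<kappa> v" by (simp add: weight_space_def)
    have "opE ?V (scale \<kappa> v) = scale \<kappa> (opE ?V v)" "opF ?V (scale \<kappa> v) = scale \<kappa> (opF ?V v)"
      by (simp_all add: verma_def lin)
    then show "opE ?V v \<in> weight_space ?V (\<kappa> + 2)" "opF ?V v \<in> weight_space ?V (\<kappa> - 2)"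
      using HE[of v] HF[of v] by (simp_all add: weight_space_def w sc)
    show "opE ?V (opF ?V v) - opF ?V (opE ?V v) = scale (qnum q \<kappa>) v"
      unfolding EF by (rule weight_space_diag[OF v])
  qed
qed

definition vidx :: "complex \<Rightarrow> complex \<Rightarrow> nat" where
  "vidx \<nu> \<alpha> = (THE k. \<alpha> = \<nu> - 2 * of_nat k)"

text \<open>\<open>xvec \<nu> \<alpha>\<close> is the vector \<open>x\<^sup>\<nu>\<close> with lower index \<open>\<alpha>\<close>, for \<open>\<alpha>\<close> in \<open>\<nu> - 2\<nat>\<close>.\<close>

definition xvec :: "complex \<Rightarrow> complex \<Rightarrow> (nat \<Rightarrow>\<^sub>0 complex)" where
  "xvec \<nu> \<alpha> = bas (vidx \<nu> \<alpha>)"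

lemma vidx_eq [simp]: "vidx \<nu> (\<nu> - 2 * of_nat k) = k"
  by (simp add: vidx_def)

lemma xvec_eq: "xvec \<nu> (\<nu> - 2 * of_nat k) = (opF (verma q \<nu>) ^^ k) (xvec \<nu> \<nu>)"
proof -
  have "xvec \<nu> \<nu> = bas 0" using vidx_eq[of \<nu> 0] by (simp add: xvec_def)
  moreover have "(opF (verma q \<nu>) ^^ k) (bas 0) = bas k"
    by (induction k) (simp_all add: verma_def)
  ultimately show ?thesis by (simp add: xvec_def)
qed


section \<open>The intertwining maps and the generalized Clebsch--Gordan coefficients\<close>

text \<open>\<open>is_Phi q \<nu> \<mu> V v \<Phi>\<close> is the defining property of the intertwining map, for a nonzero \<open>v\<close> of
  weight \<open>\<nu> - \<mu>\<close>. Note that \<open>\<mu> \<notin> \<nat>\<close> alone does not ensure that such a map exists: \<open>qnum q a\<close>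
  vanishes for all \<open>a\<close> in \<open>(2\<pi>\<i> / ln q) \<int>\<close>, and applying \<open>e\<close> to the image of the highest weight
  vector gives equations in which \<open>v\<^sub>k\<^sub>+\<^sub>1\<close> has the factor \<open>qnum q (\<mu> - k)\<close>.
  For \<open>V = verma q \<gamma>\<close> and \<open>\<nu> = \<mu> + \<gamma> - 2l\<close> there is exactly one such map if and only if
  \<open>qnum q (\<mu> - k) \<noteq> 0\<close> for all \<open>k < l\<close>.\<close>

definition is_Phi ::
  "real \<Rightarrow> complex \<Rightarrow> complex \<Rightarrow> 'b uq_mod \<Rightarrow> ('b \<Rightarrow>\<^sub>0 complex)
   \<Rightarrow> ((nat \<Rightarrow>\<^sub>0 complex) \<Rightarrow> (nat \<times> 'b \<Rightarrow>\<^sub>0 complex)) \<Rightarrow> bool" where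
  "is_Phi q \<nu> \<mu> V v \<Phi> \<longleftrightarrow>
     intertwining (verma q \<nu>) (uq_tensor q (verma q \<mu>) V) \<Phi> \<and>
     (\<exists>vs :: nat \<Rightarrow> ('b \<Rightarrow>\<^sub>0 complex). vs 0 = v \<and> finite {k. vs k \<noteq> 0} \<and>
        \<Phi> (xvec \<nu> \<nu>) = (\<Sum>k | vs k \<noteq> 0. tens ((opF (verma q \<mu>) ^^ k) (xvec \<mu> \<mu>)) (vs k)))"

definition Phi ::
  "real \<Rightarrow> complex \<Rightarrow> complex \<Rightarrow> 'b uq_mod \<Rightarrow> ('b \<Rightarrow>\<^sub>0 complex)
   \<Rightarrow> (nat \<Rightarrow>\<^sub>0 complex) \<Rightarrow> (nat \<times> 'b \<Rightarrow>\<^sub>0 complex)" where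
  "Phi q \<nu> \<mu> V v = (THE \<Phi>. is_Phi q \<nu> \<mu> V v \<Phi>)"

text \<open>\<open>clebsch_gordan q \<mu> \<gamma> \<nu> \<alpha> \<beta> \<kappa>\<close> has upper indices \<open>\<mu>, \<gamma>, \<nu>\<close> and lower indices
  \<open>\<alpha>, \<beta>, \<kappa>\<close>: it is the coefficient of \<open>tens (xvec \<mu> \<alpha>) (xvec \<gamma> \<beta>)\<close> in the image of
  \<open>xvec \<nu> \<kappa>\<close>.\<close>

definition clebsch_gordan ::
  "real \<Rightarrow> complex \<Rightarrow> complex \<Rightarrow> complex \<Rightarrow> complex \<Rightarrow> complex \<Rightarrow> complex \<Rightarrow> complex" where
  "clebsch_gordan q \<mu> \<gamma> \<nu> \<alpha> \<beta> \<kappa> =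
     Poly_Mapping.lookup (Phi q \<nu> \<mu> (verma q \<gamma>) (xvec \<gamma> (\<nu> - \<mu>)) (xvec \<nu> \<kappa>))
       (vidx \<mu> \<alpha>, vidx \<gamma> \<beta>)"

end

theory Submission
  imports Defs
begin

text \<open>An intertwining map on a Verma module is determined by the image of the highest weight vector,
  which can be any vector of the right weight annihilated by \<open>e\<close>. In the tensor product, annihilation by
  \<open>e\<close> is a first-order recurrence in \<open>m\<close> for the coefficients with \<open>N = l\<close>, and the action
  of \<open>f\<close> gives a recurrence from \<open>N\<close> to \<open>N + 1\<close>. The hypergeometric side satisfies both:
  for \<open>N = l\<close> the parameter \<open>q\<^sup>-\<^sup>N\<close> cancels and the \<open>q\<close>-Chu--Vandermonde sum gives a
  product, and the recurrence in \<open>N\<close> is the \<open>q\<close>-Pascal rule applied to each summand.\<close>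

section \<open>Linear maps on spaces with a basis\<close>

abbreviation lin :: "(('a \<Rightarrow>\<^sub>0 complex) \<Rightarrow> ('b \<Rightarrow>\<^sub>0 complex)) \<Rightarrow> bool" where
  "lin \<equiv> Vector_Spaces.linear scale scale"

lemma lin_iff: "lin f \<longleftrightarrow> (\<forall>x y. f (x + y) = f x + f y) \<and> (\<forall>c x. f (scale c x) = scale c (f x))"
  by (simp add: Vector_Spaces.linear_iff vector_space_scale)

lemma lin_add: "lin f \<Longrightarrow> f (x + y) = f x + f y"
  and lin_scale: "lin f \<Longrightarrow> f (scale c x) = scale c (f x)"
  by (simp_all add: lin_iff)

lemma lin_zero: "lin f \<Longrightarrow> f 0 = 0"
  using lin_scale[of f 0 0] by (simp add: scale_simps)

lemma lin_eqI:
  assumes "lin f" "lin g" "\<And>b. f (bas b) = g (bas b)"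
  shows "f x = g x"
  by (induction x rule: bas_induct) (use assms in \<open>auto simp: lin_add lin_scale lin_zero\<close>)

lemma lin_compose: "lin f \<Longrightarrow> lin g \<Longrightarrow> lin (\<lambda>x. f (g x))"
  by (simp add: lin_iff)

lemma lin_plus: "lin f \<Longrightarrow> lin g \<Longrightarrow> lin (\<lambda>x. f x + g x)"
  by (simp add: lin_iff scale_simps algebra_simps)

lemma lin_minus: "lin f \<Longrightarrow> lin g \<Longrightarrow> lin (\<lambda>x. f x - g x)"
  by (simp add: lin_iff scale_simps algebra_simps)

lemma lin_scaled: "lin f \<Longrightarrow> lin (\<lambda>x. scale c (f x))"
  by (simp add: lin_iff scale_simps algebra_simps)

lemma lookup_bas: "Poly_Mapping.lookup (bas a) b = (if a = b then 1 else 0)"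
  by (simp add: bas_def lookup_single when_def)

text \<open>Since \<open>tens\<close> is a nested linear extension, both sides are bilinear and
  agree on basis vectors. All bilinearity rules below are then checked coefficient by
  coefficient.\<close>

lemma lookup_tens: "Poly_Mapping.lookup (tens v w) (a, b) = Poly_Mapping.lookup v a * Poly_Mapping.lookup w b"
proof (induction v rule: bas_induct)
  case (1 a')
  show ?case
    by (induction w rule: bas_induct)
       (auto simp: tens_def lin_ext_add lin_ext_scale lookup_add lookup_bas algebra_simps)
qed (simp_all add: tens_def lin_ext_add lin_ext_scale lookup_add algebra_simps)

lemma tens_add_left: "tens (v + v') w = tens v w + tens v' w"
  and tens_add_right: "tens v (w + w') = tens v w + tens v w'"
  and tens_scale_left: "tens (scale c v) w = scale c (tens v w)"
  and tens_scale_right: "tens v (scale c w) = scale c (tens v w)"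
  and tens_bas: "tens (bas a) (bas b) = bas (a, b)"
  by (auto intro!: poly_mapping_eqI simp: lookup_tens lookup_add lookup_minus lookup_bas algebra_simps)

lemma lin_tens_left: "lin (\<lambda>v. tens v w)" and lin_tens_right: "lin (tens v)"
  by (simp_all add: lin_iff tens_add_left tens_add_right tens_scale_left tens_scale_right)

lemma lin_tens_op: "lin (tens_op A B)"
  unfolding tens_op_def by (rule linear_lin_ext)

text \<open>\<open>tens_op\<close> is prescribed on pairs of basis vectors only; linearity of
  \<open>A\<close> and \<open>B\<close> carries the rule to all pure tensors, one argument at a
  time.\<close>

lemma tens_op_tens:
  assumes "lin A" "lin B"
  shows "tens_op A B (tens v w) = tens (A v) (B w)"
proof (rule lin_eqI[where x = v and f = "\<lambda>v. tens_op A B (tens v w)" and g = "\<lambda>v. tens (A v) (B w)"])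
  show "lin (\<lambda>v. tens_op A B (tens v w))" "lin (\<lambda>v. tens (A v) (B w))"
    using assms lin_compose[OF lin_tens_op lin_tens_left] lin_compose[OF lin_tens_left] by auto
  fix a
  show "tens_op A B (tens (bas a) w) = tens (A (bas a)) (B w)"
  proof (rule lin_eqI[where x = w and f = "\<lambda>w. tens_op A B (tens (bas a) w)" and g = "\<lambda>w. tens (A (bas a)) (B w)"])
    show "lin (\<lambda>w. tens_op A B (tens (bas a) w))" "lin (\<lambda>w. tens (A (bas a)) (B w))"
      using assms lin_compose[OF lin_tens_op lin_tens_right] lin_compose[OF lin_tens_right] by auto
  qed (simp add: tens_bas tens_op_def)
qed


section \<open>Tensor products and Verma modules\<close>

lemma lin_opK: "lin (opK q c V)" and lin_opH: "lin (opH V)"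
  unfolding opK_def opH_def by (rule linear_lin_ext)+

lemma opK_weight: "v \<in> weight_space V \<alpha> \<Longrightarrow> opK q c V v = scale (qpow q (c * \<alpha>)) v"
  unfolding opK_def by (rule weight_space_diag[where c = "\<lambda>x. qpow q (c * x)"])

text \<open>h is diagonal in the given basis, so the eigenvector equation only restricts the
  support.\<close>

lemma weight_space_iff:
  "v \<in> weight_space V \<alpha> \<longleftrightarrow> (\<forall>b. wt V b = \<alpha> \<or> Poly_Mapping.lookup v b = 0)"
  unfolding weight_space_def opH_def by (auto simp: poly_mapping_eq_iff fun_eq_iff lookup_diag)

lemma bas_weight: "bas b \<in> weight_space V (wt V b)"
  by (simp add: weight_space_iff lookup_bas)

lemma tens_weight:
  assumes "v \<in> weight_space V \<alpha>" "w \<in> weight_space W \<beta>"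
  shows "tens v w \<in> weight_space (uq_tensor q V W) (\<alpha> + \<beta>)"
  using assms unfolding weight_space_iff by (auto simp: uq_tensor_def lookup_tens)

lemma weight_space_add: "v \<in> weight_space V \<alpha> \<Longrightarrow> w \<in> weight_space V \<alpha> \<Longrightarrow> v + w \<in> weight_space V \<alpha>"
  and weight_space_scale: "v \<in> weight_space V \<alpha> \<Longrightarrow> scale c v \<in> weight_space V \<alpha>"
  by (auto simp: weight_space_def lin_add[OF lin_opH] lin_scale[OF lin_opH] scale_simps mult.commute)

lemma lin_opE_tensor: "lin (opE (uq_tensor q V W))"
  and lin_opF_tensor: "lin (opF (uq_tensor q V W))"
  by (simp_all add: uq_tensor_def lin_plus lin_tens_op)

text \<open>On weight vectors the operators q^(h/4) and q^(-h/4) in the coproduct become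
  scalars.\<close>

lemma opE_tens:
  assumes "uq_module q V" "uq_module q W" "v \<in> weight_space V \<alpha>" "w \<in> weight_space W \<beta>"
  shows "opE (uq_tensor q V W) (tens v w)
    = scale (qpow q (\<beta> / 4)) (tens (opE V v) w) + scale (qpow q (- \<alpha> / 4)) (tens v (opE W w))"
  using assms unfolding uq_module_def
  by (simp add: uq_tensor_def tens_op_tens lin_opK opK_weight tens_scale_left tens_scale_right)

lemma opF_tens:
  assumes "uq_module q V" "uq_module q W" "v \<in> weight_space V \<alpha>" "w \<in> weight_space W \<beta>"
  shows "opF (uq_tensor q V W) (tens v w)
    = scale (qpow q (\<beta> / 4)) (tens (opF V v) w) + scale (qpow q (- \<alpha> / 4)) (tens v (opF W w))"
  using assms unfolding uq_module_def
  by (simp add: uq_tensor_def tens_op_tens lin_opK opK_weight tens_scale_left tens_scale_right)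

lemma uq_moduleD:
  assumes "uq_module q V"
  shows "lin (opE V)" "lin (opF V)"
    and "v \<in> weight_space V \<alpha> \<Longrightarrow> opE V v \<in> weight_space V (\<alpha> + 2)"
    and "v \<in> weight_space V \<alpha> \<Longrightarrow> opF V v \<in> weight_space V (\<alpha> - 2)"
    and "v \<in> weight_space V \<alpha> \<Longrightarrow> opE V (opF V v) = opF V (opE V v) + scale (qnum q \<alpha>) v"
proof -
  show "opE V (opF V v) = opF V (opE V v) + scale (qnum q \<alpha>) v" if "v \<in> weight_space V \<alpha>"
  proof -
    have "opE V (opF V v) - opF V (opE V v) = scale (qnum q \<alpha>) v"
      using assms that unfolding uq_module_def by blast
    then show ?thesis by (simp add: algebra_simps)
  qed
qed (use assms in \<open>auto simp: uq_module_def\<close>)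

text \<open>The two mixed terms q^((\<beta>-\<alpha>)/2) cancel. The left side is the scalar that
  the diagonal terms of the commutator on a tensor product produce.\<close>

lemma qnum_add:
  "qnum q \<alpha> * qpow q (\<beta> / 2) + qpow q (- \<alpha> / 2) * qnum q \<beta> = qnum q (\<alpha> + \<beta>)"
proof -
  have "qpow q ((\<alpha> + \<beta>) / 2) = qpow q (\<alpha> / 2) * qpow q (\<beta> / 2)"
    "qpow q (- (\<alpha> + \<beta>) / 2) = qpow q (- \<alpha> / 2) * qpow q (- \<beta> / 2)"
    by (simp_all add: powr_add[symmetric] add_divide_distrib diff_divide_distrib)
  then show ?thesis
    unfolding qnum_def times_divide_eq_left times_divide_eq_right add_divide_distrib[symmetric]
    by (simp add: algebra_simps)
qed

text \<open>The cross terms cancel: in either order of e and f, the term with f on \<open>v\<close>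
  and e on \<open>w\<close> carries the extra factor q^(1/2), and the term with e on
  \<open>v\<close> and f on \<open>w\<close> carries q^(-1/2), because one weight has been shifted
  by 2.\<close>

lemma opEF_tens:
  assumes q: "0 < q" and V: "uq_module q V" and W: "uq_module q W"
    and v: "v \<in> weight_space V \<alpha>" and w: "w \<in> weight_space W \<beta>"
  defines "T \<equiv> uq_tensor q V W"
  shows "opE T (opF T (tens v w)) - opF T (opE T (tens v w)) = scale (qnum q (\<alpha> + \<beta>)) (tens v w)"
proof -
  note vD = uq_moduleD(3-5)[OF V v] and wD = uq_moduleD(3-5)[OF W w]
  note linT = lin_opE_tensor[of q V W, folded T_def] lin_opF_tensor[of q V W, folded T_def]
  note E = opE_tens[OF V W, folded T_def] and F = opF_tens[OF V W, folded T_def]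
  let ?K = "qpow q (\<beta> / 4)" and ?L = "qpow q (- \<alpha> / 4)"
  have K: "qpow q ((\<beta> + 2) / 4) = ?K * qpow q (1/2)" "qpow q ((\<beta> - 2) / 4) = ?K * qpow q (-1/2)"
    "qpow q (- (\<alpha> - 2) / 4) = ?L * qpow q (1/2)" "qpow q (- (\<alpha> + 2) / 4) = ?L * qpow q (-1/2)"
    unfolding powr_add[symmetric] by (auto intro!: arg_cong[where f = "qpow q"] simp: field_simps)
  have KK: "?K * ?K = qpow q (\<beta> / 2)" "?L * ?L = qpow q (- \<alpha> / 2)"
    unfolding powr_add[symmetric] by (auto intro!: arg_cong[where f = "qpow q"] simp: field_simps)
  have "opE T (opF T (tens v w)) - opF T (opE T (tens v w))
      = scale (?K * ?K) (tens (opE V (opF V v)) w) - scale (?K * ?K) (tens (opF V (opE V v)) w)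
      + (scale (?L * ?L) (tens v (opE W (opF W w))) - scale (?L * ?L) (tens v (opF W (opE W w))))"
    unfolding E[OF v w] F[OF v w] lin_add[OF linT(1)] lin_add[OF linT(2)]
      lin_scale[OF linT(1)] lin_scale[OF linT(2)]
      E[OF vD(2) w] E[OF v wD(2)] F[OF vD(1) w] F[OF v wD(1)] K scale_simps
    by (simp add: mult_ac)
  also have "\<dots> = scale (qnum q \<alpha> * qpow q (\<beta> / 2) + qpow q (- \<alpha> / 2) * qnum q \<beta>) (tens v w)"
    unfolding vD(3) wD(3) KK
    by (simp add: tens_add_left tens_add_right tens_scale_left tens_scale_right scale_simps mult_ac)
  finally show ?thesis unfolding qnum_add .
qed

lemma uq_module_tensor:
  assumes "0 < q" and V: "uq_module q V" and W: "uq_module q W"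
  shows "uq_module q (uq_tensor q V W)"
proof -
  let ?T = "uq_tensor q V W"
  note linE = lin_opE_tensor[of q V W] and linF = lin_opF_tensor[of q V W]
  have wt: "wt ?T (a, b) = wt V a + wt W b" for a b
    by (simp add: uq_tensor_def)
  \<comment> \<open>A linear map that shifts the weight of every basis vector by d satisfies hf = fh
    + df, and this relation no longer refers to the basis.\<close>
  have step: "f u \<in> weight_space ?T (\<nu> + d)"
    if "lin f" "\<And>a b. f (bas (a, b)) \<in> weight_space ?T (wt ?T (a, b) + d)" "u \<in> weight_space ?T \<nu>"
    for f d u \<nu>
  proof -
    have "opH ?T (f u) = f (opH ?T u) + scale d (f u)"
    proof (rule lin_eqI[where x = u and f = "\<lambda>u. opH ?T (f u)" and g = "\<lambda>u. f (opH ?T u) + scale d (f u)"])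
      show "lin (\<lambda>u. opH ?T (f u))" "lin (\<lambda>u. f (opH ?T u) + scale d (f u))"
        by (simp_all add: lin_compose lin_plus lin_scaled lin_opH that)
      show "opH ?T (f (bas p)) = f (opH ?T (bas p)) + scale d (f (bas p))" for p
        using that(2)[of "fst p" "snd p"]
        by (simp add: weight_space_def scale_simps opH_def lin_scale[OF that(1)])
    qed
    then show ?thesis
      using that(3) by (simp add: weight_space_def lin_scale[OF that(1)] scale_simps)
  qed
  have "opE ?T (bas (a, b)) \<in> weight_space ?T (wt ?T (a, b) + 2)" for a b
  proof -
    have *: "wt V a + wt W b + 2 = (wt V a + 2) + wt W b" "wt V a + wt W b + 2 = wt V a + (wt W b + 2)"
      by simp_all
    have "tens (opE V (bas a)) (bas b) \<in> weight_space ?T (wt V a + wt W b + 2)"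
      unfolding *(1) by (intro tens_weight uq_moduleD(3)[OF V] bas_weight)
    moreover have "tens (bas a) (opE W (bas b)) \<in> weight_space ?T (wt V a + wt W b + 2)"
      unfolding *(2) by (intro tens_weight uq_moduleD(3)[OF W] bas_weight)
    ultimately show ?thesis
      unfolding tens_bas[symmetric] wt opE_tens[OF V W bas_weight bas_weight]
      by (intro weight_space_add weight_space_scale)
  qed
  \<comment> \<open>Lowering by 2 is written as adding -2 so that \<open>step\<close> covers e and f
    alike.\<close>
  moreover have "opF ?T (bas (a, b)) \<in> weight_space ?T (wt ?T (a, b) + (- 2))" for a b
  proof -
    have *: "wt V a + wt W b + - 2 = (wt V a - 2) + wt W b" "wt V a + wt W b + - 2 = wt V a + (wt W b - 2)"
      by simp_all
    have "tens (opF V (bas a)) (bas b) \<in> weight_space ?T (wt V a + wt W b + - 2)"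
      unfolding *(1) by (intro tens_weight uq_moduleD(4)[OF V] bas_weight)
    moreover have "tens (bas a) (opF W (bas b)) \<in> weight_space ?T (wt V a + wt W b + - 2)"
      unfolding *(2) by (intro tens_weight uq_moduleD(4)[OF W] bas_weight)
    ultimately show ?thesis
      unfolding tens_bas[symmetric] wt opF_tens[OF V W bas_weight bas_weight]
      by (intro weight_space_add weight_space_scale)
  qed
  moreover have "opE ?T (opF ?T u) - opF ?T (opE ?T u)
      = lin_ext (\<lambda>p. scale (qnum q (wt ?T p)) (bas p)) u" for u
  proof (rule lin_eqI[where x = u and f = "\<lambda>u. opE ?T (opF ?T u) - opF ?T (opE ?T u)"])
    show "lin (\<lambda>u. opE ?T (opF ?T u) - opF ?T (opE ?T u))"
      by (simp add: lin_minus lin_compose linE linF)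
    show "lin (lin_ext (\<lambda>p. scale (qnum q (wt ?T p)) (bas p)))"
      by (rule linear_lin_ext)
    show "opE ?T (opF ?T (bas p)) - opF ?T (opE ?T (bas p))
        = lin_ext (\<lambda>p. scale (qnum q (wt ?T p)) (bas p)) (bas p)" for p
      using opEF_tens[OF assms bas_weight bas_weight, of "fst p" "snd p"] wt[of "fst p" "snd p"]
      by (simp add: tens_bas)
  qed
  moreover have "\<exists>B. \<forall>p. Re (wt ?T p) \<le> B"
  proof -
    obtain B C where "\<And>a. Re (wt V a) \<le> B" "\<And>b. Re (wt W b) \<le> C"
      using V W unfolding uq_module_def by blast
    then show ?thesis
      by (intro exI[of _ "B + C"]) (auto simp: uq_tensor_def intro: add_mono)
  qed
  ultimately show ?thesis
    unfolding uq_module_def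
    using step[OF linE, of 2] step[OF linF, of "- 2"] weight_space_diag[where c = "qnum q"]
    by (auto simp: linE linF)
qed

section \<open>Highest weight vectors and maps out of a Verma module\<close>

lemma opF_funpow_weight:
  assumes "uq_module q V" "v \<in> weight_space V \<nu>"
  shows "(opF V ^^ k) v \<in> weight_space V (\<nu> - 2 * of_nat k)"
proof (induction k)
  case (Suc k)
  have "\<nu> - 2 * of_nat (Suc k) = \<nu> - 2 * of_nat k - 2" by simp
  then show ?case
    using uq_moduleD(4)[OF assms(1) Suc] unfolding funpow.simps comp_apply by (simp only:)
qed (use assms in simp)

text \<open>Moving e past the powers of f one at a time collects the q-numbers of \<nu>, \<nu> - 2,
  ..., \<nu> - 2k; by \<open>qnum_identity\<close> their sum telescopes to the product
  shown.\<close>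

lemma opE_opF_funpow:
  assumes "0 < q" "q < 1" and V: "uq_module q V" and v: "v \<in> weight_space V \<nu>" and E: "opE V v = 0"
  shows "opE V ((opF V ^^ Suc k) v) = scale (qnum q (of_nat (Suc k)) * qnum q (\<nu> - of_nat k)) ((opF V ^^ k) v)"
proof (induction k)
  case 0
  show ?case
    using uq_moduleD(5)[OF V v] E qnum_identity[OF assms(1,2), of 0 \<nu>]
    by (simp add: lin_zero[OF uq_moduleD(2)[OF V]] qnum_def)
next
  case (Suc k)
  have "opE V ((opF V ^^ Suc (Suc k)) v)
      = opF V (opE V ((opF V ^^ Suc k) v)) + scale (qnum q (\<nu> - 2 * of_nat (Suc k))) ((opF V ^^ Suc k) v)"
    using uq_moduleD(5)[OF V opF_funpow_weight[OF V v, of "Suc k"]] by simp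
  also have "\<dots> = scale (qnum q (of_nat (Suc k)) * qnum q (\<nu> - of_nat (Suc k) + 1)
      + qnum q (\<nu> - 2 * of_nat (Suc k))) ((opF V ^^ Suc k) v)"
    unfolding Suc lin_scale[OF uq_moduleD(2)[OF V]] by (simp add: scale_simps)
  also have "qnum q (of_nat (Suc k)) * qnum q (\<nu> - of_nat (Suc k) + 1) + qnum q (\<nu> - 2 * of_nat (Suc k))
      = qnum q (of_nat (Suc (Suc k))) * qnum q (\<nu> - of_nat (Suc k))"
    using qnum_identity[OF assms(1,2), of "of_nat (Suc k)" \<nu>] by (simp add: algebra_simps)
  finally show ?case .
qed

lemma verma_simps:
  "wt (verma q \<nu>) k = \<nu> - 2 * of_nat k"
  "opF (verma q \<nu>) (bas k) = bas (Suc k)"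
  "opE (verma q \<nu>) (bas 0) = 0"
  "opE (verma q \<nu>) (bas (Suc k)) = scale (qnum q (of_nat (Suc k)) * qnum q (\<nu> - of_nat k)) (bas k)"
proof -
  have "qnum q 0 = 0" by (simp add: qnum_def)
  then show "opE (verma q \<nu>) (bas 0) = 0" by (simp add: verma_def scale_simps)
qed (simp_all add: verma_def)

lemma verma_funpow: "(opF (verma q \<nu>) ^^ k) (bas 0) = bas k"
  by (induction k) (simp_all add: verma_simps)

text \<open>Existence half of the universal property: on the vectors f^k v the operator e acts by
  the same scalars as on the basis of the Verma module, by \<open>opE_opF_funpow\<close>.\<close>

lemma intertwining_verma:
  assumes "0 < q" "q < 1" and V: "uq_module q V" and v: "v \<in> weight_space V \<nu>" and E: "opE V v = 0"
  shows "intertwining (verma q \<nu>) V (lin_ext (\<lambda>k. (opF V ^^ k) v))"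
proof -
  let ?M = "verma q \<nu>" and ?\<Phi> = "lin_ext (\<lambda>k. (opF V ^^ k) v)"
  note linM = uq_moduleD(1,2)[OF uq_module_verma[OF assms(1,2)], of \<nu>]
  note linV = uq_moduleD(1,2)[OF V]
  have "?\<Phi> (opE ?M u) = opE V (?\<Phi> u)" for u
  proof (rule lin_eqI[where x = u and f = "\<lambda>u. ?\<Phi> (opE ?M u)" and g = "\<lambda>u. opE V (?\<Phi> u)"])
    fix k
    show "?\<Phi> (opE ?M (bas k)) = opE V (?\<Phi> (bas k))"
      using opE_opF_funpow[OF assms] E
      by (cases k) (simp_all add: verma_simps lin_ext_scale del: funpow.simps(2) of_nat_Suc)
  qed (simp_all add: lin_compose linear_lin_ext linM linV)
  moreover have "?\<Phi> (opF ?M u) = opF V (?\<Phi> u)" for u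
    by (rule lin_eqI[where x = u and f = "\<lambda>u. ?\<Phi> (opF ?M u)" and g = "\<lambda>u. opF V (?\<Phi> u)"])
       (simp_all add: lin_compose linear_lin_ext linM linV verma_simps)
  moreover have "?\<Phi> (opH ?M u) = opH V (?\<Phi> u)" for u
  proof (rule lin_eqI[where x = u and f = "\<lambda>u. ?\<Phi> (opH ?M u)" and g = "\<lambda>u. opH V (?\<Phi> u)"])
    fix k
    show "?\<Phi> (opH ?M (bas k)) = opH V (?\<Phi> (bas k))"
      using opF_funpow_weight[OF V v, of k]
      by (simp add: opH_def[of ?M] verma_simps lin_ext_scale weight_space_def)
  qed (simp_all add: lin_compose linear_lin_ext lin_opH)
  ultimately show ?thesis
    unfolding intertwining_def by (simp add: linear_lin_ext)
qed

text \<open>Uniqueness half: the Verma module is generated by its highest weight vector under f, and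
  \<Phi> commutes with f.\<close>

lemma intertwining_verma_eq:
  assumes "intertwining (verma q \<nu>) V \<Phi>"
  shows "\<Phi> = lin_ext (\<lambda>k. (opF V ^^ k) (\<Phi> (bas 0)))"
proof (rule ext, rule lin_eqI[where f = \<Phi>])
  have "\<Phi> (bas k) = (opF V ^^ k) (\<Phi> (bas 0))" for k
  proof (induction k)
    case (Suc k)
    have "\<Phi> (bas (Suc k)) = opF V (\<Phi> (bas k))"
      using assms unfolding intertwining_def by (metis verma_simps(2))
    with Suc show ?case by simp
  qed simp
  then show "\<Phi> (bas k) = lin_ext (\<lambda>k. (opF V ^^ k) (\<Phi> (bas 0))) (bas k)" for k
    unfolding lin_ext_bas .
  show "lin \<Phi>" using assms unfolding intertwining_def by blast
qed (rule linear_lin_ext)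

lemma intertwining_verma_singular:
  assumes "intertwining (verma q \<nu>) V \<Phi>"
  shows "\<Phi> (bas 0) \<in> weight_space V \<nu>" "opE V (\<Phi> (bas 0)) = 0"
proof -
  have l: "lin \<Phi>" using assms by (simp add: intertwining_def)
  have "opH (verma q \<nu>) (bas 0) = scale \<nu> (bas 0)"
    by (simp add: opH_def verma_simps)
  then show "\<Phi> (bas 0) \<in> weight_space V \<nu>"
    using assms unfolding weight_space_def mem_Collect_eq intertwining_def by (metis l lin_scale)
  show "opE V (\<Phi> (bas 0)) = 0"
    using assms unfolding intertwining_def by (metis l lin_zero verma_simps(3))
qed

section \<open>Matrix coefficients of e and f on a tensor product of Verma modules\<close>

lemma lookup_lin_eqI:
  assumes "lin g"
    and "\<And>b. Poly_Mapping.lookup (g (bas b)) p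
      = A * Poly_Mapping.lookup (bas b) r + B * Poly_Mapping.lookup (bas b) s"
  shows "Poly_Mapping.lookup (g u) p = A * Poly_Mapping.lookup u r + B * Poly_Mapping.lookup u s"
  by (induction u rule: bas_induct)
     (simp_all add: assms(2) lin_add[OF assms(1)] lin_scale[OF assms(1)] lin_zero[OF assms(1)]
       lookup_add algebra_simps)

text \<open>Position (i, j) is reached by e on the first factor from (i + 1, j) and by e on the
  second from (i, j + 1); the power of q records the weight of the factor left alone. Equated to
  zero, this is the recurrence for a vector annihilated by e.\<close>

lemma lookup_opE_verma_tensor:
  assumes "0 < q" "q < 1"
  shows "Poly_Mapping.lookup (opE (uq_tensor q (verma q \<mu>) (verma q \<gamma>)) u) (i, j)
    = qpow q ((\<gamma> - 2 * of_nat j) / 4) * (qnum q (of_nat (Suc i)) * qnum q (\<mu> - of_nat i))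
        * Poly_Mapping.lookup u (Suc i, j)
      + qpow q (- (\<mu> - 2 * of_nat i) / 4) * (qnum q (of_nat (Suc j)) * qnum q (\<gamma> - of_nat j))
        * Poly_Mapping.lookup u (i, Suc j)"
proof (rule lookup_lin_eqI[OF lin_opE_tensor])
  fix p :: "nat \<times> nat"
  obtain a b where p: "p = (a, b)" by force
  note E = opE_tens[OF uq_module_verma[OF assms] uq_module_verma[OF assms] bas_weight bas_weight,
      of \<mu> \<gamma> a b, unfolded tens_bas verma_simps(1)]
  have L: "Poly_Mapping.lookup (opE (verma q \<nu>) (bas k)) n
      = (if k = Suc n then qnum q (of_nat (Suc n)) * qnum q (\<nu> - of_nat n) else 0)" for \<nu> k n
    by (cases k) (simp_all only: verma_simps lookup_zero lookup_scale lookup_bas, simp_all)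
  show "Poly_Mapping.lookup (opE (uq_tensor q (verma q \<mu>) (verma q \<gamma>)) (bas p)) (i, j)
    = qpow q ((\<gamma> - 2 * of_nat j) / 4) * (qnum q (of_nat (Suc i)) * qnum q (\<mu> - of_nat i))
        * Poly_Mapping.lookup (bas p) (Suc i, j)
      + qpow q (- (\<mu> - 2 * of_nat i) / 4) * (qnum q (of_nat (Suc j)) * qnum q (\<gamma> - of_nat j))
        * Poly_Mapping.lookup (bas p) (i, Suc j)"
    unfolding p E lookup_add lookup_scale lookup_tens L lookup_bas prod.inject
    by (cases "a = Suc i"; cases "b = j"; cases "a = i"; cases "b = Suc j") (simp_all only: simp_thms if_True if_False mult_zero_left
       mult_zero_right mult_1_right mult_1_left add_0_left add_0_right)
qed

text \<open>Truncated subtraction at i = 0 or j = 0 is harmless because the coefficient in front is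
  then 0. \<open>cg_hahn_rec\<close> has the same shape, so the two can be matched directly.\<close>

lemma lookup_opF_verma_tensor:
  assumes "0 < q" "q < 1"
  shows "Poly_Mapping.lookup (opF (uq_tensor q (verma q \<mu>) (verma q \<gamma>)) u) (i, j)
    = (if i = 0 then 0 else qpow q ((\<gamma> - 2 * of_nat j) / 4)) * Poly_Mapping.lookup u (i - 1, j)
      + (if j = 0 then 0 else qpow q (- (\<mu> - 2 * of_nat i) / 4)) * Poly_Mapping.lookup u (i, j - 1)"
proof (rule lookup_lin_eqI[OF lin_opF_tensor])
  fix p :: "nat \<times> nat"
  obtain a b where p: "p = (a, b)" by force
  note F = opF_tens[OF uq_module_verma[OF assms] uq_module_verma[OF assms] bas_weight bas_weight,
      of \<mu> \<gamma> a b, unfolded tens_bas verma_simps(1)]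
  have L: "Poly_Mapping.lookup (opF (verma q \<nu>) (bas k)) n = (if n \<noteq> 0 \<and> k = n - 1 then 1 else 0)" for \<nu> k n
    by (cases n) (auto simp: verma_simps lookup_bas)
  show "Poly_Mapping.lookup (opF (uq_tensor q (verma q \<mu>) (verma q \<gamma>)) (bas p)) (i, j)
    = (if i = 0 then 0 else qpow q ((\<gamma> - 2 * of_nat j) / 4)) * Poly_Mapping.lookup (bas p) (i - 1, j)
      + (if j = 0 then 0 else qpow q (- (\<mu> - 2 * of_nat i) / 4)) * Poly_Mapping.lookup (bas p) (i, j - 1)"
    unfolding p F lookup_add lookup_scale lookup_tens L lookup_bas prod.inject
    by (cases "i = 0"; cases "j = 0"; cases "a = i"; cases "b = j"; cases "a = i - 1"; cases "b = j - 1")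
       (simp_all only: simp_thms if_True if_False mult_zero_left
       mult_zero_right mult_1_right mult_1_left add_0_left add_0_right)
qed


section \<open>Powers of \<open>q\<close> and \<open>q\<close>-shifted factorials\<close>

lemma qpow_neg_nat:
  assumes "0 < q"
  shows "qpow q (- of_nat n) = 1 / complex_of_real q ^ n"
  using assms by (simp add: powr_minus powr_nat' inverse_eq_divide)

lemma qpoch_0 [simp]: "qpoch a q 0 = 1"
  and qpoch_Suc: "qpoch a q (Suc k) = qpoch a q k * (1 - a * complex_of_real q ^ k)"
  by (simp_all add: qpoch_def)

lemma qpoch_Suc_left: "qpoch a q (Suc k) = (1 - a) * qpoch (a * complex_of_real q) q k"
  unfolding qpoch_def by (subst prod.lessThan_Suc_shift) (simp add: mult_ac)

lemma qpoch_eq_0_iff: "qpoch a q k = 0 \<longleftrightarrow> (\<exists>i<k. a * complex_of_real q ^ i = 1)"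
  by (auto simp: qpoch_def)

lemma cpow_eq_1_iff:
  assumes "0 < q" "q < 1"
  shows "complex_of_real q ^ n = 1 \<longleftrightarrow> n = 0"
  using assms power_strict_decreasing[of 0 n q]
  by (cases "n = 0") (auto simp: of_real_power[symmetric] simp del: of_real_power)

lemma qpoch_q_nonzero:
  assumes "0 < q" "q < 1"
  shows "qpoch (complex_of_real q) q k \<noteq> 0"
  using cpow_eq_1_iff[OF assms, of "Suc _"] by (auto simp: qpoch_eq_0_iff)

lemma qpoch_neg_eq_0_iff:
  assumes "0 < q" "q < 1"
  shows "qpoch (qpow q (- of_nat n)) q k = 0 \<longleftrightarrow> n < k"
proof -
  have "complex_of_real q ^ i = complex_of_real q ^ n \<longleftrightarrow> i = n" for i
    using power_inject_exp'[of q] assms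
    by (metis less_irrefl linorder_neqE_nat of_real_eq_iff of_real_power power_strict_decreasing)
  then show ?thesis
    using assms by (auto simp: qpoch_eq_0_iff qpow_neg_nat field_simps)
qed

text \<open>The numerator equals q^(-a/2) (q^a - 1); the denominator is the same expression at a = 1
  and does not vanish.\<close>

lemma qnum_eq_0_iff:
  assumes "0 < q" "q < 1"
  shows "qnum q a = 0 \<longleftrightarrow> qpow q a = 1"
proof -
  have *: "qpow q (z / 2) - qpow q (- z / 2) = qpow q (- z / 2) * (qpow q z - 1)" for z
    by (simp add: algebra_simps powr_add[symmetric])
  have "qpow q 1 = complex_of_real q" using assms by simp
  then have "qpow q (1 / 2) - qpow q (- 1 / 2) \<noteq> 0" unfolding *[of 1] using assms by simp
  then show ?thesis unfolding qnum_def * using assms by simp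
qed

text \<open>Past the least exponent the numerator contains a factor 1 - q^(-r) q^r, so the terms are
  0 even where a denominator vanishes too. The cut-off may thus be any terminating exponent, or
  larger.\<close>

lemma phi32_eq_sum:
  assumes "qpow q (- of_nat r) \<in> {a1, a2, a3}" "r \<le> K" "0 < q"
  shows "phi32 a1 a2 a3 b1 b2 q z = (\<Sum>k\<le>K. phi32_term a1 a2 a3 b1 b2 q z k)"
proof -
  define P where "P = (\<lambda>r::nat. qpow q (- of_nat r) \<in> {a1, a2, a3})"
  have P: "P r" using assms(1) by (simp add: P_def)
  have PL: "P (Least P)" and le: "Least P \<le> r"
    using P by (auto intro: LeastI Least_le)
  have "qpoch a1 q k * qpoch a2 q k * qpoch a3 q k = 0" if "k > Least P" for k
  proof -
    have "qpoch (qpow q (- of_nat (Least P))) q k = 0"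
      unfolding qpoch_eq_0_iff using that assms(3) by (intro exI[of _ "Least P"]) (simp add: qpow_neg_nat)
    then show ?thesis using PL by (auto simp: P_def)
  qed
  then have "(\<Sum>k\<le>Least P. phi32_term a1 a2 a3 b1 b2 q z k) = (\<Sum>k\<le>K. phi32_term a1 a2 a3 b1 b2 q z k)"
    using le assms(2) by (intro sum.mono_neutral_left) (auto simp: phi32_term_def)
  then show ?thesis
    using P unfolding phi32_def P_def by auto
qed

text \<open>The induction step holds because the summands \<open>T\<^sub>m(b, c; k)\<close> satisfy
  \<open>T\<^sub>m\<^sub>+\<^sub>1(b, c; k) = T\<^sub>m(b, c; k) - q\<^sup>-\<^sup>m (1 - b) / (1 - c) T\<^sub>m(bq, cq; k - 1)\<close>.\<close>

lemma q_chu_vandermonde: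
  assumes q: "0 < q" "q < 1" and c: "\<And>i. i < m \<Longrightarrow> c * complex_of_real q ^ i \<noteq> 1"
  shows "(\<Sum>k\<le>m. qpoch (qpow q (- of_nat m)) q k * qpoch b q k
             / (qpoch c q k * qpoch (complex_of_real q) q k) * complex_of_real q ^ k)
    = (\<Prod>i<m. b - c * complex_of_real q ^ i) / qpoch c q m"
  using c
proof (induction m arbitrary: b c)
  case 0
  show ?case by simp
next
  case (Suc m)
  define Q where "Q = complex_of_real q"
  have Q: "Q \<noteq> 0" using q by (simp add: Q_def)
  define T where "T m b c k = qpoch (1 / Q ^ m) q k * qpoch b q k / (qpoch c q k * qpoch Q q k) * Q ^ k"
    for m b c k
  define P where "P = (\<Prod>i<m. b - c * Q ^ i)"
  have c1: "1 - c \<noteq> 0" using Suc.prems[of 0] by simp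
  have cQ: "c * Q * Q ^ i \<noteq> 1" if "i < m" for i
    using Suc.prems[of "Suc i"] that by (simp add: Q_def mult_ac)
  have cm: "1 - c * Q ^ m \<noteq> 0" using Suc.prems[of m] by (simp add: Q_def)
  have cz: "qpoch c q k \<noteq> 0" if "k \<le> Suc m" for k
    using Suc.prems that by (force simp: qpoch_eq_0_iff)
  have qz: "qpoch Q q k \<noteq> 0" for k using qpoch_q_nonzero[OF q] by (simp add: Q_def)
  have step: "T (Suc m) b c (Suc k) = T m b c (Suc k) - (1 - b) / (Q ^ m * (1 - c)) * T m (b * Q) (c * Q) k"
    if "k \<le> m" for k
  proof -
    define B C D A where "B = qpoch (b * Q) q k" and "C = qpoch (c * Q) q k"
      and "D = qpoch Q q k" and "A = qpoch (1 / Q ^ m) q k"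
    have *: "qpoch b q (Suc k) = (1 - b) * B" "qpoch c q (Suc k) = (1 - c) * C"
      "qpoch Q q (Suc k) = D * (1 - Q * Q ^ k)"
      "qpoch (1 / Q ^ m) q (Suc k) = A * (1 - 1 / Q ^ m * Q ^ k)"
      "qpoch (1 / Q ^ Suc m) q (Suc k) = (1 - 1 / Q ^ Suc m) * A"
      using Q qpoch_Suc_left[of b q k] qpoch_Suc_left[of c q k] qpoch_Suc[of Q q k]
        qpoch_Suc[of "1 / Q ^ m" q k] qpoch_Suc_left[of "1 / Q ^ Suc m" q k]
      by (simp_all add: A_def B_def C_def D_def Q_def)
    have nz: "C \<noteq> 0" "D \<noteq> 0" "1 - Q * Q ^ k \<noteq> 0"
      using cz[of "Suc k"] that qz[of "Suc k"] by (auto simp: *)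
    show ?thesis
      unfolding T_def * A_def[symmetric] B_def[symmetric] C_def[symmetric] D_def[symmetric]
      using nz c1 Q by (simp add: divide_simps) (simp add: algebra_simps)
  qed
  have T0: "T m b c 0 = 1" for m b c by (simp add: T_def)
  \<comment> \<open>The sum for m may be extended by this vanishing term, which gives it the range
    of the sum for m + 1.\<close>
  have Tm: "T m b c (Suc m) = 0"
    using qpoch_neg_eq_0_iff[OF q, of m "Suc m"] q by (simp add: T_def qpow_neg_nat Q_def)
  have IH: "(\<Sum>k\<le>m. T m b' c' k) = (\<Prod>i<m. b' - c' * Q ^ i) / qpoch c' q m"
    if "\<And>i. i < m \<Longrightarrow> c' * Q ^ i \<noteq> 1" for b' c'
    using Suc.IH[of c' b'] that q by (simp add: T_def Q_def qpow_neg_nat)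
  have "(\<Sum>k\<le>Suc m. T (Suc m) b c k)
      = (T m b c 0 + (\<Sum>k\<le>m. T m b c (Suc k))) - (1 - b) / (Q ^ m * (1 - c)) * (\<Sum>k\<le>m. T m (b * Q) (c * Q) k)"
    by (simp only: sum.atMost_Suc_shift T0) (simp add: step sum_subtractf sum_distrib_left)
  also have "T m b c 0 + (\<Sum>k\<le>m. T m b c (Suc k)) = (\<Sum>k\<le>m. T m b c k)"
    using Tm by (simp only: sum.atMost_Suc_shift[symmetric]) simp
  also have "(\<Sum>k\<le>m. T m b c k) = P / qpoch c q m"
    unfolding P_def using Suc.prems by (intro IH) (auto simp: Q_def)
  \<comment> \<open>Replacing (b, c) by (bq, cq) pulls one q out of each of the m factors; this
    cancels the q^(-m) in front.\<close>
  also have "(\<Sum>k\<le>m. T m (b * Q) (c * Q) k) = Q ^ m * P / qpoch (c * Q) q m"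
  proof -
    have "(\<Prod>i<m. b * Q - c * Q * Q ^ i) = (\<Prod>i<m. Q * (b - c * Q ^ i))"
      by (intro prod.cong) (simp_all add: algebra_simps)
    also have "\<dots> = Q ^ m * P" by (simp add: prod.distrib P_def)
    finally show ?thesis using IH[OF cQ] by simp
  qed
  also have "P / qpoch c q m = P * (1 - c * Q ^ m) / qpoch c q (Suc m)"
    using cm by (simp add: qpoch_Suc Q_def)
  also have "(1 - b) / (Q ^ m * (1 - c)) * (Q ^ m * P / qpoch (c * Q) q m) = P * (1 - b) / qpoch c q (Suc m)"
    using Q by (simp add: qpoch_Suc_left Q_def)
  also have "P * (1 - c * Q ^ m) / qpoch c q (Suc m) - P * (1 - b) / qpoch c q (Suc m)
      = P * (b - c * Q ^ m) / qpoch c q (Suc m)"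
    by (simp add: diff_divide_distrib[symmetric] algebra_simps)
  finally show ?case
    using q by (simp only: T_def P_def Q_def qpow_neg_nat prod.lessThan_Suc)
qed

lemma qbinom_0: "0 < q \<Longrightarrow> q < 1 \<Longrightarrow> qbinom q N 0 = 1"
  and qbinom_self: "0 < q \<Longrightarrow> q < 1 \<Longrightarrow> qbinom q N N = 1"
  by (simp_all add: qbinom_def qpoch_q_nonzero)

text \<open>This is the \<open>q\<close>-Pascal rule, because the quotients are
  \<open>q\<^sup>(\<^sup>N\<^sup>-\<^sup>m\<^sup>)\<^sup>k\<close> times the \<open>q\<close>-binomial coefficient of \<open>N - k\<close> and
  \<open>m - k\<close>.\<close>

lemma qbinom_qpoch_pascal:
  assumes q: "0 < q" "q < 1" and "k \<le> N" "m < N"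
  shows "qbinom q (Suc N) (Suc m) * qpoch (qpow q (- of_nat (Suc m))) q k / qpoch (qpow q (- of_nat (Suc N))) q k
    = qbinom q N m * qpoch (qpow q (- of_nat m)) q k / qpoch (qpow q (- of_nat N)) q k
      + complex_of_real q ^ Suc m
        * (qbinom q N (Suc m) * qpoch (qpow q (- of_nat (Suc m))) q k / qpoch (qpow q (- of_nat N)) q k)"
proof -
  define Q where "Q = complex_of_real q"
  have Q: "Q \<noteq> 0" using q by (simp add: Q_def)
  have Q1: "1 - Q ^ Suc n \<noteq> 0" for n using cpow_eq_1_iff[OF q, of "Suc n"] by (auto simp: Q_def)
  \<comment> \<open>Split one factor off the shifted factorial of q^(-n-1) of length k + 1, once at
    the front and once at the end, and compare.\<close>
  have shift: "qpoch (qpow q (- of_nat n)) q k * (1 - Q ^ Suc n) = qpoch (qpow q (- of_nat (Suc n))) q k * (Q ^ k - Q ^ Suc n)"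
    for n
  proof -
    have a: "qpow q (- of_nat (Suc n)) * Q = qpow q (- of_nat n)"
      using q by (simp add: qpow_neg_nat Q_def del: of_nat_Suc)
    have "(1 - qpow q (- of_nat (Suc n))) * qpoch (qpow q (- of_nat n)) q k
        = qpoch (qpow q (- of_nat (Suc n))) q k * (1 - qpow q (- of_nat (Suc n)) * Q ^ k)"
      using qpoch_Suc_left[of "qpow q (- of_nat (Suc n))" q k] qpoch_Suc[of "qpow q (- of_nat (Suc n))" q k]
      by (metis Q_def a)
    moreover have "qpow q (- of_nat (Suc n)) = 1 / Q ^ Suc n"
      unfolding Q_def by (rule qpow_neg_nat[OF q(1)])
    moreover have "(Q ^ Suc n - 1) * x = y * (Q ^ Suc n - Q ^ k)"
      if "(1 - p) * x = y * (1 - p * Q ^ k)" "p = 1 / Q ^ Suc n" for p x y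
      using that Q by (simp add: field_simps)
    ultimately have "(Q ^ Suc n - 1) * qpoch (qpow q (- of_nat n)) q k
        = qpoch (qpow q (- of_nat (Suc n))) q k * (Q ^ Suc n - Q ^ k)"
      by blast
    then show ?thesis by (simp add: algebra_simps)
  qed
  obtain d where N: "N = Suc m + d" using assms(4) less_iff_Suc_add by auto
  have diffs: "N - m = Suc d" "N - Suc m = d" "Suc N - Suc m = Suc d" by (simp_all add: N)
  define y where "y = qpoch Q q"
  have y0: "y n \<noteq> 0" for n using qpoch_q_nonzero[OF q] by (simp add: y_def Q_def)
  have yS: "y (Suc n) = y n * (1 - Q ^ Suc n)" for n by (simp add: y_def qpoch_Suc Q_def)
  define A where "A = qpoch (qpow q (- of_nat (Suc m))) q k"
  define A' where "A' = qpoch (qpow q (- of_nat m)) q k"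
  define B where "B = qpoch (qpow q (- of_nat (Suc N))) q k"
  define B' where "B' = qpoch (qpow q (- of_nat N)) q k"
  have nz: "B \<noteq> 0" "B' \<noteq> 0"
    unfolding B_def B'_def qpoch_neg_eq_0_iff[OF q] using assms(3) by simp_all
  have A': "A' = A * (Q ^ k - Q ^ Suc m) / (1 - Q ^ Suc m)" 
    using shift[of m] Q1[of m] by (simp only: A_def A'_def nonzero_eq_divide_eq not_False_eq_True)
  have B': "B' * (1 - Q ^ Suc N) = B * (Q ^ k - Q ^ Suc N)" using shift[of N] by (simp only: B_def B'_def)
  have K: "Q ^ k - Q ^ Suc N \<noteq> 0" using B' nz Q1[of N] by auto
  have B'': "B' = B * (Q ^ k - Q ^ Suc N) / (1 - Q ^ Suc N)"
    using B' Q1[of N] by (simp only: nonzero_eq_divide_eq not_False_eq_True)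
  have pow: "Q ^ Suc N = Q ^ Suc m * Q ^ Suc d" by (simp add: N power_add)
  \<comment> \<open>Here u = q^(m+1), v = q^(d+1), x = q^k, hence u v = q^(N+1). After the common
    factors are removed the identity is (x - u) + u (1 - v) = x - u v.\<close>
  have gen: "yN * (1 - u * v) / (ym * (1 - u) * (yd * (1 - v))) * A / B
      = yN / (ym * (yd * (1 - v))) * (A * (x - u) / (1 - u)) / (B * (x - u * v) / (1 - u * v))
        + u * (yN / (ym * (1 - u) * yd) * A / (B * (x - u * v) / (1 - u * v)))"
    if "ym \<noteq> 0" "yd \<noteq> 0" "1 - u \<noteq> 0" "1 - v \<noteq> 0" "1 - u * v \<noteq> 0" "x - u * v \<noteq> 0" "B \<noteq> 0"
    for yN ym yd u v x A B :: complex
    using that by (simp add: divide_simps) (simp add: algebra_simps)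
  show ?thesis
    unfolding A_def[symmetric] A'_def[symmetric] B_def[symmetric] B'_def[symmetric]
    unfolding qbinom_def Q_def[symmetric] y_def[symmetric] A' B'' diffs yS pow
    by (rule gen) (use y0 Q1 nz K[unfolded pow] Q1[of N, unfolded pow] in simp_all)
qed


section \<open>Generalized Clebsch--Gordan coefficients\<close>

definition cg_hahn :: "real \<Rightarrow> complex \<Rightarrow> complex \<Rightarrow> nat \<Rightarrow> nat \<Rightarrow> nat \<Rightarrow> complex" where
  "cg_hahn q \<mu> \<gamma> l N m =
     qpow q (of_nat m / 4 * (\<mu> + \<gamma>) - \<mu> / 4 * (of_nat N - of_nat l)
             - 1 / 2 * of_nat m * (of_nat N - of_nat m))
     * qbinom q N m
     * phi32 (qpow q (- of_nat l)) (qpow q (- \<gamma> - \<mu> + of_nat l - 1)) (qpow q (- of_nat m))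
         (qpow q (- of_nat N)) (qpow q (- \<mu>)) q (complex_of_real q)"

text \<open>Both terms on the right come from the q-Pascal rule in
  \<open>qbinom_qpoch_pascal\<close>; the power of q in \<open>cg_hahn\<close> turns its
  coefficients 1 and q^i into those of the action of f.\<close>

lemma cg_hahn_rec:
  assumes q: "0 < q" "q < 1" and l: "l \<le> N" and ij: "i + j = Suc N"
  shows "cg_hahn q \<mu> \<gamma> l (Suc N) i
    = (if i = 0 then 0 else qpow q ((\<gamma> - 2 * of_nat j) / 4)) * cg_hahn q \<mu> \<gamma> l N (i - 1)
      + (if j = 0 then 0 else qpow q (- (\<mu> - 2 * of_nat i) / 4)) * cg_hahn q \<mu> \<gamma> l N i"
proof -
  \<comment> \<open>Each summand is split as \<open>t k * D N m k\<close>; only \<open>D\<close>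
    depends on N and m, so a relation among the \<open>D\<close> for each fixed k can be summed
    against \<open>t\<close>.\<close>
  define D where "D N m k = qbinom q N m * qpoch (qpow q (- of_nat m)) q k / qpoch (qpow q (- of_nat N)) q k"
    for N m k
  define t where "t k = qpoch (qpow q (- of_nat l)) q k * qpoch (qpow q (- \<gamma> - \<mu> + of_nat l - 1)) q k
    / (qpoch (qpow q (- \<mu>)) q k * qpoch (complex_of_real q) q k) * complex_of_real q ^ k" for k
  define S where "S N m = (\<Sum>k\<le>l. t k * D N m k)" for N m
  define X where "X N m = qpow q (of_nat m / 4 * (\<mu> + \<gamma>) - \<mu> / 4 * (of_nat N - of_nat l)
             - 1 / 2 * of_nat m * (of_nat N - of_nat m))" for N m
  have G: "cg_hahn q \<mu> \<gamma> l N m = X N m * S N m" for N m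
    unfolding cg_hahn_def S_def X_def t_def D_def using q
    by (subst phi32_eq_sum[where r = l and K = l])
       (simp_all add: phi32_term_def sum_distrib_left mult_ac)
  have D0: "D n 0 k = (if k = 0 then 1 else 0)" for n k
    using q by (auto simp: D_def qbinom_0 qpoch_eq_0_iff)
  have DN: "D n n k = 1" if "k \<le> n" for n k
    unfolding D_def qbinom_self[OF q]
    using qpoch_neg_eq_0_iff[OF q, of n k] that by simp
  \<comment> \<open>The Pascal rule needs both neighbours. At i = 0 only the summand k = 0 survives;
    at j = 0 the factor q^(-m) with m = N cancels q^(-N), as k \<le> l \<le> N.\<close>
  consider "i = 0" "j = Suc N" | "j = 0" "i = Suc N" | m d where "i = Suc m" "j = Suc d" "N = Suc (m + d)"
    using ij by (cases i; cases j) auto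
  then show ?thesis
  proof cases
    case 1
    have "X (Suc N) 0 = qpow q (- \<mu> / 4) * X N 0"
      unfolding X_def powr_add[symmetric]
      by (rule arg_cong[where f = "qpow q"]) (simp add: field_simps)
    then show ?thesis by (simp add: 1 G S_def D0)
  next
    case 2
    have "X (Suc N) (Suc N) = qpow q (\<gamma> / 4) * X N N"
      unfolding X_def powr_add[symmetric]
      by (rule arg_cong[where f = "qpow q"]) (simp add: field_simps)
    moreover have "S (Suc N) (Suc N) = S N N"
      unfolding S_def using l by (intro sum.cong) (simp_all add: DN)
    ultimately show ?thesis by (simp add: 2 G)
  next
    case 3
    have X1: "X (Suc N) i = qpow q ((\<gamma> - 2 * of_nat j) / 4) * X N m"
      unfolding X_def powr_add[symmetric]
      by (rule arg_cong[where f = "qpow q"]) (simp add: 3 field_simps)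
    have pw: "complex_of_real q ^ i = qpow q (of_nat i)"
      using q by (simp add: powr_nat')
    have X2: "X (Suc N) i * complex_of_real q ^ i = qpow q (- (\<mu> - 2 * of_nat i) / 4) * X N i"
      unfolding X_def pw powr_add[symmetric]
      by (rule arg_cong[where f = "qpow q"]) (simp add: 3 field_simps)
    have "D (Suc N) i k = D N m k + complex_of_real q ^ i * D N i k" if "k \<le> l" for k
      unfolding D_def 3(1) by (rule qbinom_qpoch_pascal[OF q]) (use that l 3 in auto)
    then have "S (Suc N) i = S N m + complex_of_real q ^ i * S N i"
      unfolding S_def by (simp add: sum.distrib sum_distrib_left algebra_simps)
    then have "X (Suc N) i * S (Suc N) i
        = X (Suc N) i * S N m + X (Suc N) i * complex_of_real q ^ i * S N i"
      by (simp add: distrib_left)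
    also have "\<dots> = qpow q ((\<gamma> - 2 * of_nat j) / 4) * X N m * S N m
        + qpow q (- (\<mu> - 2 * of_nat i) / 4) * X N i * S N i"
      unfolding X2 unfolding X1 ..
    finally show ?thesis
      unfolding G using 3 by (simp only: mult.assoc) simp
  qed
qed

text \<open>Translates a nonzero q-number into a nonzero factor of the shifted factorial of
  q^(-\<mu>), as \<open>q_chu_vandermonde\<close> requires.\<close>

lemma qpow_ne_1:
  assumes "0 < q" "q < 1" "qnum q (\<mu> - of_nat i) \<noteq> 0"
  shows "qpow q (- \<mu>) * complex_of_real q ^ i \<noteq> 1"
proof
  assume "qpow q (- \<mu>) * complex_of_real q ^ i = 1"
  then have "complex_of_real q ^ i = qpow q \<mu>"
    using assms(1) by (simp add: powr_minus field_simps)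
  then have "qpow q (\<mu> - of_nat i) = 1"
    using assms(1) by (simp add: powr_diff powr_nat')
  then show False using assms qnum_eq_0_iff by blast
qed

lemma cg_hahn_diag:
  assumes q: "0 < q" "q < 1" and \<mu>: "\<forall>k<l. qnum q (\<mu> - of_nat k) \<noteq> 0" and m: "m \<le> l"
  shows "cg_hahn q \<mu> \<gamma> l l m
    = qpow q (of_nat m / 4 * (\<mu> + \<gamma>) - 1 / 2 * of_nat m * (of_nat l - of_nat m)) * qbinom q l m
      * ((\<Prod>i<m. qpow q (- \<gamma> - \<mu> + of_nat l - 1) - qpow q (- \<mu>) * complex_of_real q ^ i)
         / qpoch (qpow q (- \<mu>)) q m)"
proof -
  let ?b = "qpow q (- \<gamma> - \<mu> + of_nat l - 1)" and ?c = "qpow q (- \<mu>)" and ?Q = "complex_of_real q"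
  \<comment> \<open>Both q^(-l) and q^(-m) terminate the series. Cutting at m \<le> l keeps k where
    the factorial of q^(-l) is nonzero and cancels between numerator and denominator.\<close>
  have "phi32 (qpow q (- of_nat l)) ?b (qpow q (- of_nat m)) (qpow q (- of_nat l)) ?c q ?Q
      = (\<Sum>k\<le>m. phi32_term (qpow q (- of_nat l)) ?b (qpow q (- of_nat m)) (qpow q (- of_nat l)) ?c q ?Q k)"
    using q by (intro phi32_eq_sum[where r = m]) auto
  also have "\<dots> = (\<Sum>k\<le>m. qpoch (qpow q (- of_nat m)) q k * qpoch ?b q k
             / (qpoch ?c q k * qpoch ?Q q k) * ?Q ^ k)"
  proof (rule sum.cong)
    fix k assume "k \<in> {..m}"
    then have "qpoch (qpow q (- of_nat l)) q k \<noteq> 0"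
      using m by (simp add: qpoch_neg_eq_0_iff[OF q])
    then show "phi32_term (qpow q (- of_nat l)) ?b (qpow q (- of_nat m)) (qpow q (- of_nat l)) ?c q ?Q k
      = qpoch (qpow q (- of_nat m)) q k * qpoch ?b q k / (qpoch ?c q k * qpoch ?Q q k) * ?Q ^ k"
      unfolding phi32_term_def mult.assoc by (simp add: mult.commute)
  qed simp
  also have "\<dots> = (\<Prod>i<m. ?b - ?c * ?Q ^ i) / qpoch ?c q m"
    by (rule q_chu_vandermonde[OF q]) (use \<mu> m in \<open>auto intro!: qpow_ne_1[OF q]\<close>)
  finally show ?thesis by (simp add: cg_hahn_def)
qed

text \<open>This is the vanishing of the coefficient at (k, j) in
  \<open>lookup_opE_verma_tensor\<close>. The product form in \<open>cg_hahn_diag\<close> makes the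
  ratio of consecutive values elementary, and its denominators cancel against the q-numbers.\<close>

lemma cg_hahn_diag_rec:
  assumes q: "0 < q" "q < 1" and \<mu>: "\<forall>k<l. qnum q (\<mu> - of_nat k) \<noteq> 0" and l: "l = Suc (k + j)"
  shows "qpow q ((\<gamma> - 2 * of_nat j) / 4) * (qnum q (of_nat (Suc k)) * qnum q (\<mu> - of_nat k))
        * cg_hahn q \<mu> \<gamma> l l (Suc k)
      + qpow q (- (\<mu> - 2 * of_nat k) / 4) * (qnum q (of_nat (Suc j)) * qnum q (\<gamma> - of_nat j))
        * cg_hahn q \<mu> \<gamma> l l k = 0"
proof -
  define Q where "Q = complex_of_real q"
  define d where "d = qpow q (1 / 2) - qpow q (- 1 / 2)"
  \<comment> \<open>In terms of M and g the parameters become b = 1/(M g) and c q^k = 1/M, and both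
    q-numbers containing \<mu> or \<gamma> are expressed by M - 1 and g - 1.\<close>
  define M where "M = qpow q (\<mu> - of_nat k)"
  define g where "g = qpow q (\<gamma> - of_nat j)"
  define r where "r = qpow q ((\<mu> + \<gamma>) / 4 - (of_nat j - of_nat k) / 2)"
  define X where "X m = qpow q (of_nat m / 4 * (\<mu> + \<gamma>) - 1 / 2 * of_nat m * (of_nat l - of_nat m))" for m
  define b c where "b = qpow q (- \<gamma> - \<mu> + of_nat l - 1)" and "c = qpow q (- \<mu>)"
  have nz: "M \<noteq> 0" "g \<noteq> 0" using q by (auto simp: M_def g_def)
  have qn: "qnum q z = qpow q (- z / 2) * (qpow q z - 1) / d" for z
    unfolding qnum_def d_def by (simp add: algebra_simps powr_add[symmetric])
  have pw: "qpow q (of_nat n) = Q ^ n" for n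
    using q by (simp add: Q_def powr_nat')
  have M1: "M \<noteq> 1" using \<mu> l q unfolding M_def by (auto simp: qnum_eq_0_iff)
  have U1: "1 - Q ^ Suc n \<noteq> 0" for n using cpow_eq_1_iff[OF q, of "Suc n"] by (auto simp: Q_def)
  have yS: "qpoch Q q (Suc n) = qpoch Q q n * (1 - Q ^ Suc n)" for n
    by (simp add: qpoch_Suc Q_def)
  have y0: "qpoch Q q n \<noteq> 0" for n using qpoch_q_nonzero[OF q] by (simp add: Q_def)
  have bin: "qbinom q l (Suc k) = qbinom q l k * ((1 - Q ^ Suc j) / (1 - Q ^ Suc k))"
  proof -
    have "l - Suc k = j" "l - k = Suc j" using l by simp_all
    then show ?thesis
      unfolding qbinom_def Q_def[symmetric] using y0 U1
      by (simp add: yS divide_simps del: power_Suc)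
  qed
  have cQ: "c * Q ^ k = 1 / M"
    using q by (simp add: c_def M_def powr_diff powr_minus pw field_simps)
  have bM: "b = 1 / (M * g)"
  proof -
    have "- \<gamma> - \<mu> + of_nat l - 1 = - (\<mu> - of_nat k) - (\<gamma> - of_nat j)"
      by (simp add: l)
    then show ?thesis
      by (simp only: b_def M_def g_def powr_diff[of _ "- (\<mu> - of_nat k)"] powr_minus) (simp add: field_simps)
  qed
  have Xr: "X (Suc k) = X k * r"
    unfolding X_def r_def powr_add[symmetric]
    by (rule arg_cong[where f = "qpow q"]) (simp add: l field_simps)
  have step: "cg_hahn q \<mu> \<gamma> l l (Suc k) = cg_hahn q \<mu> \<gamma> l l k * r
      * ((1 - Q ^ Suc j) / (1 - Q ^ Suc k)) * ((1 - g) / (g * (M - 1)))"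
  proof -
    have form: "cg_hahn q \<mu> \<gamma> l l n = X n * qbinom q l n * ((\<Prod>i<n. b - c * Q ^ i) / qpoch c q n)"
      if "n \<le> l" for n
      unfolding X_def b_def c_def Q_def by (rule cg_hahn_diag[OF q \<mu> that])
    have qpoch_Suc_Q: "qpoch c q (Suc n) = qpoch c q n * (1 - c * Q ^ n)" for n
      unfolding Q_def by (rule qpoch_Suc)
    have le: "Suc k \<le> l" "k \<le> l" using l by simp_all
    have e: "(1 / (M * g) - 1 / M) / (1 - 1 / M) = (1 - g) / (g * (M - 1))"
      using nz M1 by (simp add: divide_simps)
    have "cg_hahn q \<mu> \<gamma> l l (Suc k) = cg_hahn q \<mu> \<gamma> l l k * r
      * ((1 - Q ^ Suc j) / (1 - Q ^ Suc k)) * ((1 / (M * g) - 1 / M) / (1 - 1 / M))"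
      unfolding form[OF le(1)] form[OF le(2)] Xr bin qpoch_Suc_Q prod.lessThan_Suc cQ bM
      by (simp add: mult_ac del: power_Suc)
    then show ?thesis unfolding e .
  qed
  \<comment> \<open>Writing each q-number as q^(-z/2) (q^z - 1)/d leaves these powers of q; r is the
    ratio of the prefactors \<open>X\<close>.\<close>
  have expo: "qpow q ((\<gamma> - 2 * of_nat j) / 4) * qpow q (- of_nat (Suc k) / 2) * qpow q (- (\<mu> - of_nat k) / 2) * r
      = qpow q (- (\<mu> - 2 * of_nat k) / 4) * qpow q (- of_nat (Suc j) / 2) * qpow q (- (\<gamma> - of_nat j) / 2) * g"
    unfolding r_def g_def powr_add[symmetric]
    by (rule arg_cong[where f = "qpow q"]) (simp add: field_simps)
  \<comment> \<open>Used with U = q^(k+1) and V = q^(j+1): the factors U - 1 and M - 1 cancel, and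
    the sign comes from 1 - V, 1 - U and 1 - g being reversed while M - 1 is not.\<close>
  have alg: "A * ((u * (U - 1) / d) * (m * (M - 1) / d)) * (G * r * ((1 - V) / (1 - U)) * ((1 - g) / (g * (M - 1))))
      + B * ((v * (V - 1) / d) * (n * (g - 1) / d)) * G = 0"
    if "A * u * m * r = B * v * n * g" "1 - U \<noteq> 0" for A u U m G V B v n
  proof -
    have cancel: "A * ((u * a / d) * (m * b / d)) * (G * r * (- v' / - a) * (- p / (g * b)))
        = - ((A * u * m * r) * G * v' * p / (g * d * d))" if "a \<noteq> 0" "b \<noteq> 0" for a b v' p
      using that nz by (simp add: divide_simps)
    have "A * ((u * (U - 1) / d) * (m * (M - 1) / d)) * (G * r * ((1 - V) / (1 - U)) * ((1 - g) / (g * (M - 1))))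
      = - ((A * u * m * r) * G * (V - 1) * (g - 1) / (g * d * d))"
      using cancel[of "U - 1" "M - 1" "V - 1" "g - 1"] that M1 by simp
    also have "\<dots> = - ((B * v * n * g) * G * (V - 1) * (g - 1) / (g * d * d))"
      unfolding that(1) ..
    also have "\<dots> = - (B * ((v * (V - 1) / d) * (n * (g - 1) / d)) * G)"
      using nz by simp
    finally show ?thesis by simp
  qed
  show ?thesis
    unfolding step qn M_def[symmetric] g_def[symmetric] pw
    by (rule alg[OF expo]) (rule U1)
qed

text \<open>This is the normalization v_0 = v of the intertwining map.\<close>

lemma cg_hahn_diag_0: "0 < q \<Longrightarrow> q < 1 \<Longrightarrow> \<forall>k<l. qnum q (\<mu> - of_nat k) \<noteq> 0 \<Longrightarrow> cg_hahn q \<mu> \<gamma> l l 0 = 1"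
  by (simp add: cg_hahn_diag qbinom_0)

section \<open>Construction and uniqueness of the intertwining map, and its coefficients\<close>

lemma lookup_sum_tens_bas:
  assumes "finite {k. vs k \<noteq> 0}"
  shows "Poly_Mapping.lookup (\<Sum>k | vs k \<noteq> 0. tens (bas k) (vs k)) (i, j) = Poly_Mapping.lookup (vs i) j"
proof -
  have "Poly_Mapping.lookup (\<Sum>k | vs k \<noteq> 0. tens (bas k) (vs k)) (i, j)
      = (\<Sum>k | vs k \<noteq> 0. if k = i then Poly_Mapping.lookup (vs i) j else 0)"
    unfolding lookup_sum by (intro sum.cong) (auto simp: lookup_tens lookup_bas)
  then show ?thesis using assms by (auto simp: sum.delta)
qed

text \<open>The nonvanishing of the q-numbers of \<mu> - k for k < l enters twice: it keeps the
  denominators of the closed form nonzero, and it lets the recurrence from e be solved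
  uniquely.\<close>

lemma clebsch_gordan_eq_cg_hahn:
  assumes q: "0 < q" "q < 1" and \<mu>: "\<forall>k<l. qnum q (\<mu> - of_nat k) \<noteq> 0"
    and l: "l \<le> N" and m: "m \<le> N"
  shows "clebsch_gordan q \<mu> \<gamma> (\<mu> + \<gamma> - 2 * of_nat l)
           (\<mu> - 2 * of_nat m) (\<gamma> - 2 * of_nat N + 2 * of_nat m) (\<mu> + \<gamma> - 2 * of_nat N)
         = cg_hahn q \<mu> \<gamma> l N m"
proof -
  define T where "T = uq_tensor q (verma q \<mu>) (verma q \<gamma>)"
  define \<nu> where "\<nu> = \<mu> + \<gamma> - 2 * of_nat l"
  define G where "G = cg_hahn q \<mu> \<gamma> l l"
  have T: "uq_module q T"
    unfolding T_def using q by (intro uq_module_tensor uq_module_verma)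
  note lookup_E = lookup_opE_verma_tensor[OF q, of \<mu> \<gamma>, folded T_def]
  note lookup_F = lookup_opF_verma_tensor[OF q, of \<mu> \<gamma>, folded T_def]
  note G_rec = cg_hahn_diag_rec[OF q \<mu>, where \<gamma> = \<gamma>, folded G_def]
  have G0: "G 0 = 1" unfolding G_def by (rule cg_hahn_diag_0[OF q \<mu>])
  have wtT: "wt T (i, j) = \<nu> \<longleftrightarrow> i + j = l" for i j
  proof -
    have "wt T (i, j) = \<nu> \<longleftrightarrow> 2 * (of_nat (i + j) :: complex) = 2 * of_nat l"
      by (auto simp: T_def uq_tensor_def verma_simps \<nu>_def algebra_simps)
    then show ?thesis by (simp only: mult_cancel_left of_nat_eq_iff) simp
  qed
  have x0: "xvec \<alpha> \<alpha> = bas 0" for \<alpha>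
    using vidx_eq[of \<alpha> 0] by (simp add: xvec_def)
  have xl: "xvec \<gamma> (\<nu> - \<mu>) = bas l"
    using vidx_eq[of \<gamma> l] by (simp add: xvec_def \<nu>_def)
  \<comment> \<open>The candidate image w of the highest weight vector: its coefficient at (k, l -
    k) is the closed form for N = l.\<close>
  define vs :: "nat \<Rightarrow> (nat \<Rightarrow>\<^sub>0 complex)" where
    "vs = (\<lambda>k. if k \<le> l then scale (G k) (bas (l - k)) else 0)"
  define w where "w = (\<Sum>k | vs k \<noteq> 0. tens (bas k) (vs k))"
  have fin: "finite {k. vs k \<noteq> 0}"
    by (rule finite_subset[of _ "{..l}"]) (auto simp: vs_def)
  have lookup_w: "Poly_Mapping.lookup w (i, j) = (if i + j = l then G i else 0)" for i j
    unfolding w_def lookup_sum_tens_bas[OF fin] by (auto simp: vs_def lookup_bas)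
  have w_wt: "w \<in> weight_space T \<nu>"
    unfolding weight_space_iff using wtT lookup_w by auto
  have "opE T w = 0"
  proof (rule poly_mapping_eqI)
    fix p :: "nat \<times> nat"
    obtain i j where p: "p = (i, j)" by force
    show "Poly_Mapping.lookup (opE T w) p = Poly_Mapping.lookup 0 p"
    \<comment> \<open>Both coefficients of w that contribute have index sum i + j + 1. If this is
      not l they vanish by weight; otherwise the recurrence for \<open>G\<close> applies.\<close>
    proof (cases "l = Suc (i + j)")
      case True
      then have "Suc i + j = l" "i + Suc j = l" by simp_all
      then show ?thesis
        unfolding p lookup_E lookup_w using G_rec[OF True] by (simp only: refl if_True lookup_zero)
    next
      case False
      then show ?thesis
        unfolding p lookup_E lookup_w by simp
    qed
  qed
  note inter = intertwining_verma[OF q T w_wt this]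
  define \<Phi> where "\<Phi> = lin_ext (\<lambda>k. (opF T ^^ k) w)"
  have ex: "is_Phi q \<nu> \<mu> (verma q \<gamma>) (xvec \<gamma> (\<nu> - \<mu>)) \<Phi>"
    unfolding is_Phi_def x0 verma_funpow xl T_def[symmetric]
  proof (intro conjI exI)
    show "vs 0 = bas l" by (simp add: vs_def G0 scale_simps)
    show "\<Phi> (bas 0) = (\<Sum>k | vs k \<noteq> 0. tens (bas k) (vs k))"
      by (simp add: \<Phi>_def w_def)
  qed (use inter fin in \<open>simp_all add: \<Phi>_def\<close>)
  have uniq: "\<Psi> = \<Phi>" if "is_Phi q \<nu> \<mu> (verma q \<gamma>) (xvec \<gamma> (\<nu> - \<mu>)) \<Psi>" for \<Psi>
  proof -
    from that[unfolded is_Phi_def x0 verma_funpow xl, folded T_def]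
    obtain us where \<Psi>: "intertwining (verma q \<nu>) T \<Psi>" and us0: "us 0 = bas l"
      and fin': "finite {k. us k \<noteq> 0}" and us: "\<Psi> (bas 0) = (\<Sum>k | us k \<noteq> 0. tens (bas k) (us k))"
      by blast
    let ?u = "\<Psi> (bas 0)"
    note sing = intertwining_verma_singular[OF \<Psi>]
    have off: "Poly_Mapping.lookup ?u (i, j) = 0" if "i + j \<noteq> l" for i j
      using sing(1) wtT that unfolding weight_space_iff by blast
    have "Poly_Mapping.lookup ?u (i, j) = G i" if "i + j = l" for i j
      using that
    proof (induction i arbitrary: j)
      case 0
      then show ?case
        unfolding us lookup_sum_tens_bas[OF fin'] us0 by (simp add: lookup_bas G0)
    next
      case (Suc i)
      have lS: "l = Suc (i + j)" using Suc.prems by simp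
      let ?A = "qpow q ((\<gamma> - 2 * of_nat j) / 4) * (qnum q (of_nat (Suc i)) * qnum q (\<mu> - of_nat i))"
      have "qpow q (of_nat (Suc i)) = complex_of_real q ^ Suc i"
        using q by (simp add: powr_nat' del: power_Suc of_nat_Suc)
      then have "qnum q (of_nat (Suc i)) \<noteq> 0"
        unfolding qnum_eq_0_iff[OF q] using cpow_eq_1_iff[OF q] by (metis nat.distinct(1))
      \<comment> \<open>With this factor nonzero, annihilation by e determines the coefficient at (i
        + 1, j) from the one at (i, j + 1), so a competing map has the same image of the highest
        weight vector.\<close>
      then have A: "?A \<noteq> 0" using \<mu> lS q by (auto simp del: of_nat_Suc)
      have "?A * Poly_Mapping.lookup ?u (Suc i, j)
          + qpow q (- (\<mu> - 2 * of_nat i) / 4) * (qnum q (of_nat (Suc j)) * qnum q (\<gamma> - of_nat j))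
            * Poly_Mapping.lookup ?u (i, Suc j) = 0"
        using lookup_E[of ?u i j] sing(2) by simp
      moreover have "Poly_Mapping.lookup ?u (i, Suc j) = G i"
        by (rule Suc.IH) (simp add: lS)
      ultimately have "?A * Poly_Mapping.lookup ?u (Suc i, j) = ?A * G (Suc i)"
        using G_rec[OF lS] by (metis add_right_cancel)
      then show ?case using A by simp
    qed
    then have u: "?u = w"
      by (intro poly_mapping_eqI) (metis lookup_w off surj_pair)
    show ?thesis
      unfolding \<Phi>_def using intertwining_verma_eq[OF \<Psi>, unfolded u] .
  qed
  have Phi: "Phi q \<nu> \<mu> (verma q \<gamma>) (xvec \<gamma> (\<nu> - \<mu>)) = \<Phi>"
    unfolding Phi_def by (rule the_equality) (rule ex, erule uniq)
  \<comment> \<open>Each application of f raises N by one: \<open>lookup_F\<close> and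
    \<open>cg_hahn_rec\<close> have identical coefficients, and n = 0 is the vector w.\<close>
  have main: "Poly_Mapping.lookup ((opF T ^^ n) w) (i, j) = cg_hahn q \<mu> \<gamma> l (l + n) i" if "i + j = l + n" for n i j
    using that
  proof (induction n arbitrary: i j)
    case 0
    then show ?case by (simp add: lookup_w G_def)
  next
    case (Suc n)
    have "Poly_Mapping.lookup ((opF T ^^ n) w) (i - 1, j) = cg_hahn q \<mu> \<gamma> l (l + n) (i - 1)" if "i \<noteq> 0"
      using Suc.prems that by (intro Suc.IH) auto
    moreover have "Poly_Mapping.lookup ((opF T ^^ n) w) (i, j - 1) = cg_hahn q \<mu> \<gamma> l (l + n) i" if "j \<noteq> 0"
      using Suc.prems that by (intro Suc.IH) auto
    ultimately show ?case
      using cg_hahn_rec[OF q, of l "l + n" i j \<mu> \<gamma>] Suc.prems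
      by (cases "i = 0"; cases "j = 0") (simp_all add: lookup_F)
  qed
  have "\<mu> + \<gamma> - 2 * of_nat N = \<nu> - 2 * of_nat (N - l)"
    using l by (simp add: \<nu>_def of_nat_diff)
  then have k: "xvec \<nu> (\<mu> + \<gamma> - 2 * of_nat N) = bas (N - l)"
    by (simp only: xvec_def vidx_eq)
  have "\<gamma> - 2 * of_nat N + 2 * of_nat m = \<gamma> - 2 * of_nat (N - m)"
    using m by (simp add: of_nat_diff)
  then have "vidx \<gamma> (\<gamma> - 2 * of_nat N + 2 * of_nat m) = N - m"
    by (simp only: vidx_eq)
  then show ?thesis
    unfolding clebsch_gordan_def \<nu>_def[symmetric] Phi k
    using main[of m "N - m" "N - l"] l m by (simp add: \<Phi>_def)
qed

text \<open>With a = q^(-\<mu>-1) and b = q^(-\<gamma>-1) the parameters qa and q^(l+1) a b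
  simplify; the lower parameters then stand in the opposite order, to which the terms of the series
  are insensitive.\<close>

lemma q_hahn_eq_phi32:
  assumes "0 < q"
  shows "q_hahn l x (qpow q (- \<mu> - 1)) (qpow q (- \<gamma> - 1)) N q
    = phi32 (qpow q (- of_nat l)) (qpow q (- \<gamma> - \<mu> + of_nat l - 1)) x
        (qpow q (- of_nat N)) (qpow q (- \<mu>)) q (complex_of_real q)"
proof -
  have "qpow q 1 = complex_of_real q" using assms by simp
  then have "complex_of_real q * qpow q (- \<mu> - 1) = qpow q (1 + (- \<mu> - 1))"
    by (simp only: powr_add)
  then have b: "complex_of_real q * qpow q (- \<mu> - 1) = qpow q (- \<mu>)" by simp
  have a: "qpow q (of_nat l + 1) * qpow q (- \<mu> - 1) * qpow q (- \<gamma> - 1) = qpow q (- \<gamma> - \<mu> + of_nat l - 1)"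
    unfolding powr_add[symmetric] by (rule arg_cong[where f = "qpow q"]) simp
  have swap: "phi32_term a1 a2 a3 b1 b2 q z = phi32_term a1 a2 a3 b2 b1 q z" for a1 a2 a3 b1 b2 z
    by (simp add: phi32_term_def fun_eq_iff mult.commute)
  show ?thesis
    unfolding q_hahn_def a b phi32_def swap[of _ _ _ "qpow q (- \<mu>)"] ..
qed

theorem theorem3p5:
  fixes q :: real and \<mu> \<gamma> :: complex and N l m :: nat
  assumes "0 < q" and "q < 1"
    and "\<mu> \<notin> \<nat>"
    and "\<forall>k<l. qnum q (\<mu> - of_nat k) \<noteq> 0"
    and "l \<le> N" and "m \<le> N"
  shows "clebsch_gordan q \<mu> \<gamma> (\<mu> + \<gamma> - 2 * of_nat l)
           (\<mu> - 2 * of_nat m) (\<gamma> - 2 * of_nat N + 2 * of_nat m) (\<mu> + \<gamma> - 2 * of_nat N)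
         = qpow q (of_nat m / 4 * (\<mu> + \<gamma>) - \<mu> / 4 * (of_nat N - of_nat l)
                   - 1 / 2 * of_nat m * (of_nat N - of_nat m))
           * qbinom q N m
           * q_hahn l (qpow q (- of_nat m)) (qpow q (- \<mu> - 1)) (qpow q (- \<gamma> - 1)) N q
       \<and> clebsch_gordan q \<mu> \<gamma> (\<mu> + \<gamma> - 2 * of_nat l)
           (\<mu> - 2 * of_nat m) (\<gamma> - 2 * of_nat N + 2 * of_nat m) (\<mu> + \<gamma> - 2 * of_nat N)
         = qpow q (of_nat m / 4 * (\<mu> + \<gamma>) - \<mu> / 4 * (of_nat N - of_nat l)
                   - 1 / 2 * of_nat m * (of_nat N - of_nat m))
           * qbinom q N m
           * phi32 (qpow q (- of_nat l)) (qpow q (- \<gamma> - \<mu> + of_nat l - 1)) (qpow q (- of_nat m))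
               (qpow q (- of_nat N)) (qpow q (- \<mu>)) q (complex_of_real q)"
  unfolding q_hahn_eq_phi32[OF assms(1)] clebsch_gordan_eq_cg_hahn[OF assms(1,2,4-6)] cg_hahn_def
  by simp

end
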